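(* For Lebesgue-almost every $x\in(0,1)$, the sequence $(q_n(x))_{n\in\mathbb N}$ is a Benford sequence. Equivalently, for Lebesgue-almost every $x\in(0,1)$, the sequence $(\log_{10} q_n(x))_{n\in\mathbb N}$ is uniformly distributed mod $1$.
   Context: For irrational $x\in(0,1)$ write its continued fraction expansion $x=[a_1,a_2,\ldots]=1/(a_1+1/(a_2+\cdots))$ with $a_i\in\mathbb N$, and let $p_n/q_n=[a_1,\ldots,a_n]$ (in lowest terms, $q_n\geq 1$) be its $n$-th convergent; $q_n(x)$ denotes this denominator. A sequence $(x_n)$ of real numbers is uniformly distributed (u.d.) mod $1$ if for every $t\in[0,1)$, $\lim_{N\to\infty}\frac1N\#\{1\le n\le N:\{x_n\}\le t\}=t$, where $\{\cdot\}$ denotes the fractional part. For nonzero real $y$, its decimal significand $s(y)$ is the unique $t\in[1,10)$ with $|y|=10^k t$ for some $k\in\mathbb Z$. A sequence $(x_n)$ of nonzero reals is a Benford sequence if $\lim_{N\to\infty}\frac1N\#\{1\le n\le N: s(x_n)\le t\}=\log_{10}(t)$ for all $t\in[1,10)$. *)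

theory Defs
  imports "HOL-Analysis.Analysis"
begin

definition gauss_map :: "real \<Rightarrow> real" where
  "gauss_map x = 1 / x - of_int \<lfloor>1 / x\<rfloor>"

definition cf_digit :: "nat \<Rightarrow> real \<Rightarrow> nat" where
  "cf_digit n x = nat \<lfloor>1 / (gauss_map ^^ (n - 1)) x\<rfloor>"

fun cf_value :: "nat list \<Rightarrow> rat" where
  "cf_value [] = 0"
| "cf_value (a # as) = 1 / (of_nat a + cf_value as)"

definition cf_denom :: "nat \<Rightarrow> real \<Rightarrow> int" where
  "cf_denom n x = snd (quotient_of (cf_value (map (\<lambda>i. cf_digit i x) [1..<n+1])))"

definition significand :: "real \<Rightarrow> real" where
  "significand y = (THE t. 1 \<le> t \<and> t < 10 \<and> (\<exists>k::int. \<bar>y\<bar> = 10 powr (real_of_int k) * t))"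

definition benford :: "(nat \<Rightarrow> real) \<Rightarrow> bool" where
  "benford x \<longleftrightarrow> (\<forall>n\<ge>1. x n \<noteq> 0) \<and>
     (\<forall>t. 1 \<le> t \<and> t < 10 \<longrightarrow>
        (\<lambda>N. real (card {n \<in> {1..N}. significand (x n) \<le> t}) / real N) \<longlonglongrightarrow> log 10 t)"

end

theory Submission
  imports Defs "HOL-Real_Asymp.Real_Asymp" "HOL-Library.Discrete_Functions"
begin

text \<open>
  Write \<open>r = q\<^sub>n\<^sub>-\<^sub>1 / q\<^sub>n\<close>. On a cylinder of rank \<open>n\<close> the image of Lebesgue measure under the \<open>n\<close>-th iterate of
  the Gauss map has density \<open>(1 + r) / (1 + r t)\<^sup>2\<close>, so under Lebesgue measure the ratios \<open>r\<close> form a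
  Markov chain that moves from \<open>r\<close> to \<open>1 / (k + r)\<close> with probability
  \<open>(1 + r) / ((k + r) (k + 1 + r))\<close>, and \<open>q\<^sub>n\<close> is the product of the factors \<open>k + r\<close>.
  For real \<open>\<alpha> \<noteq> 0\<close> the correlations of \<open>q\<^sub>m powr (\<i> \<alpha>)\<close> and \<open>q\<^sub>n powr (\<i> \<alpha>)\<close> are therefore governed by
  the transition operator twisted by \<open>(k + r) powr (\<i> \<alpha>)\<close>. On Lipschitz functions this
  operator is a strict contraction: branches with large \<open>k\<close> all land near \<open>0\<close>, where the function is
  nearly constant, while the phase \<open>\<alpha> ln (k + r)\<close> keeps rotating, so that these branches
  partly cancel. The correlations thus decay exponentially in \<open>\<bar>n - m\<bar>\<close>, the exponential sums have
  mean square \<open>O(N)\<close>, and Weyl's criterion applies almost everywhere.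
\<close>

section \<open>The twisted transition operator\<close>

text \<open>The index \<open>k\<close> stands for the partial quotient \<open>k + 1\<close>.\<close>

definition digit_weight :: "nat \<Rightarrow> real \<Rightarrow> real" where
  "digit_weight k r = (1 + r) / ((real k + 1 + r) * (real k + 2 + r))"

definition twisted_transfer :: "real \<Rightarrow> (real \<Rightarrow> complex) \<Rightarrow> real \<Rightarrow> complex" where
  "twisted_transfer \<alpha> f r =
     (\<Sum>k. of_real (digit_weight k r) * cis (\<alpha> * ln (real k + 1 + r)) * f (1 / (real k + 1 + r)))"

text \<open>The Lipschitz constant is tied to \<open>M\<close>, so for fixed \<open>L\<close> > 0
  these are the balls of radius \<open>M\<close> in one norm combining supremum and Lipschitz
  constant. A contraction can then be stated by shrinking \<open>M\<close> alone.\<close>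

definition lipschitz_bounded :: "real \<Rightarrow> real \<Rightarrow> (real \<Rightarrow> complex) \<Rightarrow> bool" where
  "lipschitz_bounded L M f \<longleftrightarrow>
     (\<forall>r\<in>{0..1}. cmod (f r) \<le> M) \<and>
     (\<forall>r\<in>{0..1}. \<forall>s\<in>{0..1}. cmod (f r - f s) \<le> L * M * \<bar>r - s\<bar>)"

section \<open>Distribution of a single digit\<close>

lemma digit_weight_nonneg: "0 \<le> r \<Longrightarrow> 0 \<le> digit_weight k r"
  by (simp add: digit_weight_def)

lemma digit_weight_telescope:
  assumes "0 \<le> r"
  shows "digit_weight k r = (1 + r) / (real k + 1 + r) - (1 + r) / (real (Suc k) + 1 + r)"
proof -
  have "real k + 1 + r \<noteq> 0" "real k + 2 + r \<noteq> 0" using assms by auto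
  then show ?thesis by (simp add: digit_weight_def divide_simps) (simp add: algebra_simps)
qed

text \<open>By telescoping. The value is the probability that the index is at least
  \<open>K\<close>; this is the mass on which cancellation will be gained.\<close>

lemma digit_weight_tail_sums:
  assumes "0 \<le> r"
  shows "(\<lambda>k. digit_weight (k + K) r) sums ((1 + r) / (real K + 1 + r))"
proof -
  let ?g = "\<lambda>k. (1 + r) / (real (k + K) + 1 + r)"
  have "?g \<longlonglongrightarrow> 0" by real_asymp
  from telescope_sums'[OF this]
  have "(\<lambda>k. ?g k - ?g (Suc k)) sums (?g 0 - 0)" .
  moreover have "?g k - ?g (Suc k) = digit_weight (k + K) r" for k
    using digit_weight_telescope[OF assms, of "k + K"] by simp
  ultimately show ?thesis by simp
qed

lemma digit_weight_sums: "0 \<le> r \<Longrightarrow> (\<lambda>k. digit_weight k r) sums 1"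
  using digit_weight_tail_sums[of r 0] by (simp add: add_pos_nonneg)

section \<open>Cancellation in the phases of large digits\<close>

text \<open>First-order expansion of (1 + 1/y) to the power \<i> \<alpha>. The Taylor remainder of
  the exponential contributes the term with the square of \<alpha>, the gap between
  \<open>ln (1 + 1 / y)\<close> and \<open>1 / y\<close> the linear one.\<close>

lemma cmod_cis_increment_le:
  assumes "1 \<le> (y::real)"
  shows "cmod (cis (\<alpha> * ln (1 + 1 / y)) - 1 - \<i> * of_real (\<alpha> / y)) \<le> (\<alpha>\<^sup>2 + \<bar>\<alpha>\<bar>) / y\<^sup>2"
proof -
  define \<theta> where "\<theta> = ln (1 + 1 / y)"
  have y: "y > 0" using assms by simp
  have up: "\<theta> \<le> 1 / y" unfolding \<theta>_def using y by (intro ln_add_one_self_le_self) auto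
  have lo: "1 / y - (1 / y)\<^sup>2 \<le> \<theta>" unfolding \<theta>_def using assms
    by (intro ln_one_plus_pos_lower_bound) auto
  have nn: "0 \<le> \<theta>" unfolding \<theta>_def using y by simp
  have "cmod (exp (\<i> * of_real (\<alpha> * \<theta>)) - (\<Sum>k\<le>1. (\<i> * of_real (\<alpha> * \<theta>)) ^ k / fact k))
        \<le> exp \<bar>Re (\<i> * of_real (\<alpha> * \<theta>))\<bar> * cmod (\<i> * of_real (\<alpha> * \<theta>)) ^ Suc 1 / fact 1"
    by (rule Taylor_exp)
  then have 1: "cmod (cis (\<alpha> * \<theta>) - 1 - \<i> * of_real (\<alpha> * \<theta>)) \<le> (\<alpha> * \<theta>)\<^sup>2"
    by (simp add: cis_conv_exp norm_mult power2_eq_square abs_mult algebra_simps)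
  have "(\<alpha> * \<theta>)\<^sup>2 \<le> \<alpha>\<^sup>2 * (1 / y)\<^sup>2"
    unfolding power_mult_distrib using up nn by (intro mult_left_mono power_mono) auto
  with 1 have 2: "cmod (cis (\<alpha> * \<theta>) - 1 - \<i> * of_real (\<alpha> * \<theta>)) \<le> \<alpha>\<^sup>2 / y\<^sup>2"
    by (simp add: power_divide)
  have "cmod (\<i> * of_real (\<alpha> * \<theta>) - \<i> * of_real (\<alpha> / y)) = \<bar>\<alpha>\<bar> * \<bar>\<theta> - 1 / y\<bar>"
  proof -
    have "\<i> * of_real (\<alpha> * \<theta>) - \<i> * of_real (\<alpha> / y) = \<i> * of_real (\<alpha> * (\<theta> - 1 / y))"
      by (simp add: algebra_simps)
    then show ?thesis by (simp only: norm_mult norm_ii norm_of_real abs_mult mult_1_left)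
  qed
  also have "\<dots> \<le> \<bar>\<alpha>\<bar> * (1 / y)\<^sup>2"
    using up lo by (intro mult_left_mono) auto
  finally have 3: "cmod (\<i> * of_real (\<alpha> * \<theta>) - \<i> * of_real (\<alpha> / y)) \<le> \<bar>\<alpha>\<bar> / y\<^sup>2"
    by (simp add: power_divide)
  have "cis (\<alpha> * \<theta>) - 1 - \<i> * of_real (\<alpha> / y) = (cis (\<alpha> * \<theta>) - 1 - \<i> * of_real (\<alpha> * \<theta>))
        + (\<i> * of_real (\<alpha> * \<theta>) - \<i> * of_real (\<alpha> / y))" by simp
  then have "cmod (cis (\<alpha> * \<theta>) - 1 - \<i> * of_real (\<alpha> / y)) \<le> \<alpha>\<^sup>2 / y\<^sup>2 + \<bar>\<alpha>\<bar> / y\<^sup>2"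
    using norm_triangle_le[of _ _ "\<alpha>\<^sup>2 / y\<^sup>2 + \<bar>\<alpha>\<bar> / y\<^sup>2"] 2 3 by (metis add_mono)
  then show ?thesis by (simp add: \<theta>_def add_divide_distrib)
qed

text \<open>The derivative of \<open>y powr (\<i> \<alpha> - 1)\<close> explains the factor 1 - \<i>
  \<alpha> in front of its one-step decrease. The difference to be bounded is, by exact algebra, the
  error term of \<open>cmod_cis_increment_le\<close> up to a factor.\<close>

lemma cmod_power_increment_le:
  assumes "1 \<le> (y::real)"
  shows "cmod ((1 - \<i> * of_real \<alpha>) * cis (\<alpha> * ln y) / of_real (y * (y + 1))
            - (cis (\<alpha> * ln y) / of_real y - cis (\<alpha> * ln (y + 1)) / of_real (y + 1)))
         \<le> (\<alpha>\<^sup>2 + \<bar>\<alpha>\<bar>) / y * (1 / (y * (y + 1)))"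
proof -
  have y: "y > 0" using assms by simp
  define c where "c = cis (\<alpha> * ln y)"
  define d where "d = cis (\<alpha> * ln (1 + 1 / y))"
  have "y + 1 = y * (1 + 1 / y)" "0 < 1 + 1 / y" using y by (simp_all add: field_simps add_pos_pos)
  then have "ln (y + 1) = ln y + ln (1 + 1 / y)" using ln_mult_pos[OF y] by presburger
  then have "cis (\<alpha> * ln (y + 1)) = c * d"
    by (simp add: c_def d_def cis_mult algebra_simps)
  moreover have "(1 - \<i> * of_real \<alpha>) * c / of_real (y * (y + 1)) - (c / of_real y - c * d / of_real (y + 1))
      = c * of_real y * (d - 1 - \<i> * of_real (\<alpha> / y)) / of_real (y * (y + 1))"
  proof -
    have "complex_of_real y \<noteq> 0" "complex_of_real y + 1 \<noteq> 0"
      using y by (simp_all add: complex_eq_iff)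
    then show ?thesis by (simp add: divide_simps) (simp add: algebra_simps)
  qed
  ultimately have "cmod ((1 - \<i> * of_real \<alpha>) * c / of_real (y * (y + 1)) - (c / of_real y - cis (\<alpha> * ln (y + 1)) / of_real (y + 1)))
     = y * cmod (d - 1 - \<i> * of_real (\<alpha> / y)) / (y * (y + 1))"
    using y by (simp add: norm_mult norm_divide c_def del: of_real_mult of_real_add of_real_divide)
  also have "\<dots> \<le> y * ((\<alpha>\<^sup>2 + \<bar>\<alpha>\<bar>) / y\<^sup>2) / (y * (y + 1))"
    using cmod_cis_increment_le[OF assms, of \<alpha>] y
    by (intro divide_right_mono mult_left_mono) (auto simp: d_def)
  also have "\<dots> = (\<alpha>\<^sup>2 + \<bar>\<alpha>\<bar>) / y * (1 / (y * (y + 1)))"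
    using y by (simp add: power2_eq_square)
  finally show ?thesis by (simp add: c_def)
qed

lemma summable_digit_weight_mult:
  fixes f :: "nat \<Rightarrow> complex"
  assumes "0 \<le> r" and "\<And>k. cmod (f k) \<le> B"
  shows "summable (\<lambda>k. of_real (digit_weight k r) * f k)"
proof -
  have "summable (\<lambda>k. digit_weight k r * B)"
    using digit_weight_sums[OF assms(1)] by (intro summable_mult2) (auto simp: sums_iff)
  then have "summable (\<lambda>k. cmod (of_real (digit_weight k r) * f k))"
    by (rule summable_comparison_test'[where N = 0])
      (auto simp: norm_mult digit_weight_nonneg assms intro!: mult_left_mono)
  then show "summable (\<lambda>k. of_real (digit_weight k r) * f k)"
    by (rule summable_norm_cancel)
qed

lemma cmod_digit_weight_sum_le:
  fixes f :: "nat \<Rightarrow> complex"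
  assumes "0 \<le> r" and "\<And>k. cmod (f k) \<le> B"
  shows "cmod (\<Sum>k. of_real (digit_weight k r) * f k) \<le> B"
proof -
  have "cmod (\<Sum>k. of_real (digit_weight k r) * f k) \<le> (\<Sum>k. digit_weight k r * B)"
  proof (rule norm_suminf_le)
    show "summable (\<lambda>k. digit_weight k r * B)"
      using digit_weight_sums[OF assms(1)] by (intro summable_mult2) (auto simp: sums_iff)
  qed (auto simp: norm_mult digit_weight_nonneg assms intro!: mult_left_mono)
  also have "\<dots> = B"
    using digit_weight_sums[OF assms(1)] by (subst suminf_mult2[symmetric]) (auto simp: sums_iff)
  finally show ?thesis .
qed

text \<open>The oscillation of \<open>y powr (\<i> \<alpha>)\<close> gains a factor \<open>\<bar>1 - \<i> \<alpha>\<bar>\<close> over the trivial bound: up to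
  lower order, the summands are the increments of \<open>y powr (\<i> \<alpha> - 1) / (1 - \<i> \<alpha>)\<close>.\<close>

lemma digit_weight_oscillating_tail:
  assumes r: "0 \<le> r"
  shows "cmod (1 - \<i> * of_real \<alpha>) *
      cmod (\<Sum>k. of_real (digit_weight (k + K) r) * cis (\<alpha> * ln (real (k + K) + 1 + r)))
    \<le> (1 + (\<alpha>\<^sup>2 + \<bar>\<alpha>\<bar>) / (real K + 1)) * ((1 + r) / (real K + 1 + r))"
proof -
  define C where "C = \<alpha>\<^sup>2 + \<bar>\<alpha>\<bar>"
  have C: "C \<ge> 0" by (simp add: C_def)
  define y where "y k = real (k + K) + 1 + r" for k
  define w where "w k = digit_weight (k + K) r" for k
  define g where "g k = of_real (1 + r) * cis (\<alpha> * ln (y k)) / of_real (y k)" for k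
  define e where "e k = (1 - \<i> * of_real \<alpha>) * (of_real (w k) * cis (\<alpha> * ln (y k))) - (g k - g (Suc k))" for k
  have y1: "y k \<ge> real K + 1" for k using r by (simp add: y_def)
  then have ypos: "y k > 0" for k by (smt (verit) of_nat_0_le_iff)
  have ySuc: "y (Suc k) = y k + 1" for k by (simp add: y_def)
  have w: "w k = (1 + r) * (1 / (y k * (y k + 1)))" for k
    by (simp add: w_def y_def digit_weight_def add_ac)
  have wsums: "w sums ((1 + r) / (real K + 1 + r))"
    using digit_weight_tail_sums[OF r, of K] by (simp add: w_def[abs_def])
  have e_le: "cmod (e k) \<le> C / (real K + 1) * w k" for k
  proof -
    have "e k = of_real (1 + r) * ((1 - \<i> * of_real \<alpha>) * cis (\<alpha> * ln (y k)) / of_real (y k * (y k + 1))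
            - (cis (\<alpha> * ln (y k)) / of_real (y k) - cis (\<alpha> * ln (y k + 1)) / of_real (y k + 1)))"
      unfolding e_def w g_def ySuc by (simp add: algebra_simps)
    then have "cmod (e k) = (1 + r) * cmod ((1 - \<i> * of_real \<alpha>) * cis (\<alpha> * ln (y k)) / of_real (y k * (y k + 1))
            - (cis (\<alpha> * ln (y k)) / of_real (y k) - cis (\<alpha> * ln (y k + 1)) / of_real (y k + 1)))"
      using r by (simp only: norm_mult norm_of_real)
    also have "\<dots> \<le> (1 + r) * (C / y k * (1 / (y k * (y k + 1))))"
      unfolding C_def using r y1[of k] by (intro mult_left_mono cmod_power_increment_le) auto
    also have "\<dots> = C / y k * w k" by (simp add: w)
    also have "\<dots> \<le> C / (real K + 1) * w k"
      using C y1[of k] r by (intro mult_right_mono divide_left_mono) (auto simp: w_def digit_weight_nonneg intro!: mult_pos_pos ypos)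
    finally show ?thesis .
  qed
  have "g \<longlonglongrightarrow> 0"
  proof (rule Lim_null_comparison)
    show "\<forall>\<^sub>F k in sequentially. cmod (g k) \<le> (1 + r) / y k"
      using r ypos by (auto simp: g_def norm_mult norm_divide less_imp_le simp del: of_real_add intro!: always_eventually)
    show "(\<lambda>k. (1 + r) / y k) \<longlonglongrightarrow> 0" unfolding y_def by real_asymp
  qed
  \<comment> \<open>The main part collapses to \<open>g 0\<close>, whose modulus is just the mass of
    the tail; the defects \<open>e k\<close> add at most \<open>C / (real K + 1)\<close> times that
    mass.\<close>
  from telescope_sums'[OF this] have gs: "(\<lambda>k. g k - g (Suc k)) sums g 0" by simp
  have s1: "summable (\<lambda>k. C / (real K + 1) * w k)" using wsums by (intro summable_mult) (auto simp: sums_iff)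
  have es: "summable e" by (rule summable_comparison_test'[OF s1, of 0]) (rule e_le)
  have "cmod (suminf e) \<le> (\<Sum>k. C / (real K + 1) * w k)"
    using e_le s1 by (rule norm_suminf_le)
  also have "\<dots> = C / (real K + 1) * ((1 + r) / (real K + 1 + r))"
    using wsums by (subst suminf_mult) (auto simp: sums_iff)
  finally have e2: "cmod (suminf e) \<le> \<dots>" .
  have "(\<lambda>k. e k + (g k - g (Suc k))) sums (suminf e + g 0)"
    using es gs by (intro sums_add) auto
  then have s2: "(\<lambda>k. (1 - \<i> * of_real \<alpha>) * (of_real (w k) * cis (\<alpha> * ln (y k)))) sums (suminf e + g 0)"
    by (simp add: e_def)
  have "1 - \<i> * of_real \<alpha> \<noteq> 0" by (simp add: complex_eq_iff)
  with s2 have "(\<lambda>k. of_real (w k) * cis (\<alpha> * ln (y k))) sums ((suminf e + g 0) / (1 - \<i> * of_real \<alpha>))"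
    using sums_divide[OF s2, of "1 - \<i> * of_real \<alpha>"] by simp
  then have "cmod (1 - \<i> * of_real \<alpha>) * cmod (\<Sum>k. of_real (w k) * cis (\<alpha> * ln (y k))) = cmod (suminf e + g 0)"
    using \<open>1 - \<i> * of_real \<alpha> \<noteq> 0\<close> by (simp add: sums_iff norm_divide)
  also have "\<dots> \<le> C / (real K + 1) * ((1 + r) / (real K + 1 + r)) + (1 + r) / (real K + 1 + r)"
  proof (rule norm_triangle_mono[OF e2])
    show "cmod (g 0) \<le> (1 + r) / (real K + 1 + r)"
      using r by (simp add: g_def y_def norm_mult norm_divide del: of_real_add)
  qed
  also have "\<dots> = (1 + C / (real K + 1)) * ((1 + r) / (real K + 1 + r))"
    by (simp only: distrib_right mult_1_left add.commute)
  finally show ?thesis unfolding w_def y_def C_def .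
qed

text \<open>The factor \<open>r - s\<close> splits off over a common denominator. The resulting
  Lipschitz constants have total 2 over all \<open>k\<close>, which permits estimating the operator
  term by term.\<close>

lemma abs_digit_weight_diff_le:
  assumes "0 \<le> r" "r \<le> 1" "0 \<le> s" "s \<le> 1"
  shows "\<bar>digit_weight k r - digit_weight k s\<bar> \<le> 2 * digit_weight k 0 * \<bar>r - s\<bar>"
proof -
  define a where "a = real k + 1"
  have a: "a \<ge> 1" by (simp add: a_def)
  have pos: "(a + r) * (a + 1 + r) \<ge> a * (a + 1)" "(a + s) * (a + 1 + s) \<ge> a * (a + 1)"
    using assms a by (auto intro!: mult_mono)
  have p0: "a * (a + 1) > 0" using a by simp
  \<comment> \<open>This is the cofactor of \<open>r - s\<close> in the numerator of the difference
    computed below.\<close>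
  have num: "\<bar>a * (a + 1) - (2 * a + 1) - (r + s) - r * s\<bar> \<le> 2 * (a * (a + 1))"
  proof -
    have "0 \<le> r * s" "r * s \<le> 1" using assms by (auto simp: mult_le_one)
    moreover have "a * a \<ge> 1" using a mult_mono[of 1 a 1 a] by simp
    ultimately show ?thesis using a assms unfolding abs_le_iff distrib_left by linarith
  qed
  have "digit_weight k r - digit_weight k s = (1 + r) / ((a + r) * (a + 1 + r)) - (1 + s) / ((a + s) * (a + 1 + s))"
    by (simp add: digit_weight_def a_def add_ac)
  also have "\<dots> = ((1 + r) * ((a + s) * (a + 1 + s)) - (1 + s) * ((a + r) * (a + 1 + r)))
      / (((a + r) * (a + 1 + r)) * ((a + s) * (a + 1 + s)))"
    using pos p0 by (subst diff_frac_eq) auto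
  also have "(1 + r) * ((a + s) * (a + 1 + s)) - (1 + s) * ((a + r) * (a + 1 + r))
      = (r - s) * (a * (a + 1) - (2 * a + 1) - (r + s) - r * s)"
    by (simp add: algebra_simps)
  finally have "\<bar>digit_weight k r - digit_weight k s\<bar>
     = \<bar>r - s\<bar> * \<bar>a * (a + 1) - (2 * a + 1) - (r + s) - r * s\<bar> / (((a + r) * (a + 1 + r)) * ((a + s) * (a + 1 + s)))"
    using assms a by (simp add: abs_mult)
  also have "\<dots> \<le> \<bar>r - s\<bar> * (2 * (a * (a + 1))) / ((a * (a + 1)) * (a * (a + 1)))"
  proof (rule frac_le)
    show "\<bar>r - s\<bar> * \<bar>a * (a + 1) - (2 * a + 1) - (r + s) - r * s\<bar> \<le> \<bar>r - s\<bar> * (2 * (a * (a + 1)))"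
      using num by (rule mult_left_mono) simp
    show "(a * (a + 1)) * (a * (a + 1)) \<le> ((a + r) * (a + 1 + r)) * ((a + s) * (a + 1 + s))"
      using pos p0 by (intro mult_mono[OF pos]) linarith+
    show "0 < (a * (a + 1)) * (a * (a + 1))" using p0 p0 by (rule mult_pos_pos)
    show "0 \<le> \<bar>r - s\<bar> * (2 * (a * (a + 1)))" using p0 by simp
  qed
  also have "\<dots> = 2 * (1 / (a * (a + 1))) * \<bar>r - s\<bar>"
  proof -
    have "x * (2 * p) / (p * p) = 2 * (1 / p) * x" if "p > 0" for x p :: real
      using that by simp
    then show ?thesis using p0 by blast
  qed
  also have "1 / (a * (a + 1)) = digit_weight k 0"
    by (simp add: digit_weight_def a_def add_ac)
  finally show ?thesis .
qed

lemma cmod_cis_diff_le: "cmod (cis x - cis y) \<le> \<bar>x - y\<bar>"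
proof -
  have "cis x - cis y = cis y * (cis (x - y) - 1)"
    by (simp add: cis_mult algebra_simps)
  then have "cmod (cis x - cis y) = cmod (exp (\<i> * of_real (x - y)) - 1)"
    by (simp add: norm_mult cis_conv_exp)
  also have "\<dots> \<le> \<bar>x - y\<bar>"
    using Taylor_exp[of "\<i> * of_real (x - y)" 0] by (simp add: norm_mult del: of_real_diff)
  finally show ?thesis .
qed

lemma abs_ln_diff_le:
  assumes "1 \<le> (x::real)" "1 \<le> y"
  shows "\<bar>ln x - ln y\<bar> \<le> \<bar>x - y\<bar>"
proof -
  have *: "ln a - ln b \<le> \<bar>a - b\<bar>" if "1 \<le> a" "1 \<le> b" for a b :: real
  proof -
    have "ln a - ln b \<le> (a - b) / b" using that by (intro ln_diff_le) auto
    also have "\<dots> \<le> \<bar>a - b\<bar> / b" using that by (intro divide_right_mono) auto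
    also have "\<dots> \<le> \<bar>a - b\<bar> / 1" using that by (intro divide_left_mono) auto
    finally show ?thesis by simp
  qed
  from *[OF assms] *[OF assms(2,1)] show ?thesis by auto
qed

lemma inverse_shift_mem: "0 \<le> r \<Longrightarrow> 1 / (real k + 1 + r) \<in> {0..1}"
  by (auto simp: field_simps)

text \<open>The weight, the phase and \<open>f\<close> are varied one at a time; they cost 2,
  \<bar>\<alpha>\<bar> and 5/8 \<open>L\<close>. The branch \<open>k = 0\<close> need not contract
  distances but has weight at most 1/2, all others contract by 1/4, and 1/4 + 1/2 * 3/4 = 5/8. What
  matters is that this is below 1.\<close>

lemma twisted_transfer_lipschitz:
  assumes f: "lipschitz_bounded L M f" and "0 \<le> L" "0 \<le> M"
    and r: "r \<in> {0..1}" and s: "s \<in> {0..1}"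
  shows "cmod (twisted_transfer \<alpha> f r - twisted_transfer \<alpha> f s) \<le> (2 + \<bar>\<alpha>\<bar> + 5 / 8 * L) * M * \<bar>r - s\<bar>"
proof -
  define w where "w k x = digit_weight k x" for k x
  define u where "u k x = cis (\<alpha> * ln (real k + 1 + x))" for k and x :: real
  define v where "v k x = f (1 / (real k + 1 + x))" for k x
  \<comment> \<open>Every branch is charged the factor 1/4 for \<open>f\<close>, and
    \<open>k = 0\<close> the missing 3/4, so the majorant sums by total weight 1 plus one single
    term.\<close>
  define b where "b k = 2 * w k 0 * (M * \<bar>r - s\<bar>) + w k s * ((\<bar>\<alpha>\<bar> + L / 4) * M * \<bar>r - s\<bar>)
      + (if k = 0 then w k s * (3 / 4 * L * M * \<bar>r - s\<bar>) else 0)" for k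
  have w0: "w k x \<ge> 0" if "x \<ge> 0" for k x using that by (simp add: w_def digit_weight_nonneg)
  have vM: "cmod (v k x) \<le> M" if "x \<ge> 0" for k x
    using f inverse_shift_mem[OF that, of k] by (auto simp: v_def lipschitz_bounded_def)
  have u1: "cmod (u k x) = 1" for k x by (simp add: u_def)
  have summ: "summable (\<lambda>k. of_real (w k x) * u k x * v k x)" if "x \<ge> 0" for x
    using summable_digit_weight_mult[OF that, of "\<lambda>k. u k x * v k x" M] vM[OF that] u1
    by (simp add: norm_mult w_def mult.assoc)
  have term_le: "cmod (of_real (w k r) * u k r * v k r - of_real (w k s) * u k s * v k s) \<le> b k" for k
  proof -
    have du: "cmod (u k r - u k s) \<le> \<bar>\<alpha>\<bar> * \<bar>r - s\<bar>"
    proof -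
      have "cmod (u k r - u k s) \<le> \<bar>\<alpha> * ln (real k + 1 + r) - \<alpha> * ln (real k + 1 + s)\<bar>"
        unfolding u_def by (rule cmod_cis_diff_le)
      also have "\<dots> = \<bar>\<alpha>\<bar> * \<bar>ln (real k + 1 + r) - ln (real k + 1 + s)\<bar>"
        by (simp add: abs_mult flip: right_diff_distrib)
      also have "\<dots> \<le> \<bar>\<alpha>\<bar> * \<bar>(real k + 1 + r) - (real k + 1 + s)\<bar>"
        using r s by (intro mult_left_mono abs_ln_diff_le) auto
      finally show ?thesis by simp
    qed
    have dv: "cmod (v k r - v k s) \<le> L * M * (if k = 0 then 1 else 1 / 4) * \<bar>r - s\<bar>"
    proof -
      have "1 / (real k + 1 + r) - 1 / (real k + 1 + s) = (s - r) / ((real k + 1 + r) * (real k + 1 + s))"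
        using r s by (subst diff_frac_eq) auto
      also have "\<bar>\<dots>\<bar> = \<bar>r - s\<bar> / ((real k + 1 + r) * (real k + 1 + s))"
        using r s by (simp add: abs_mult abs_minus_commute)
      also have "\<dots> \<le> \<bar>r - s\<bar> / (if k = 0 then 1 else 4)"
      proof (intro divide_left_mono)
        show "(if k = 0 then 1 else 4) \<le> (real k + 1 + r) * (real k + 1 + s)"
        proof (cases "k = 0")
          case True
          then show ?thesis using r s mult_mono[of 1 "1 + r" 1 "1 + s"] by auto
        next
          case False
          then have "real k \<ge> 1" by simp
          then show ?thesis using r s False mult_mono[of 2 "real k + 1 + r" 2 "real k + 1 + s"] by auto
        qed
      qed (use r s in auto)
      also have "\<dots> = (if k = 0 then 1 else 1 / 4) * \<bar>r - s\<bar>" by simp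
      finally have "L * M * \<bar>1 / (real k + 1 + r) - 1 / (real k + 1 + s)\<bar>
          \<le> L * M * ((if k = 0 then 1 else 1 / 4) * \<bar>r - s\<bar>)"
        using assms(2,3) by (intro mult_left_mono) auto
      moreover have "cmod (v k r - v k s) \<le> L * M * \<bar>1 / (real k + 1 + r) - 1 / (real k + 1 + s)\<bar>"
        using f r s inverse_shift_mem[of r k] inverse_shift_mem[of s k]
        unfolding v_def lipschitz_bounded_def by auto
      ultimately show ?thesis by (simp only: mult.assoc)
    qed
    have dw: "\<bar>w k r - w k s\<bar> \<le> 2 * w k 0 * \<bar>r - s\<bar>"
      unfolding w_def using r s by (intro abs_digit_weight_diff_le) auto
    have "of_real (w k r) * u k r * v k r - of_real (w k s) * u k s * v k s
        = of_real (w k r - w k s) * (u k r * v k r) + of_real (w k s) * ((u k r - u k s) * v k r)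
          + of_real (w k s) * (u k s * (v k r - v k s))"
      by (simp add: algebra_simps)
    also have "cmod \<dots> \<le> \<bar>w k r - w k s\<bar> * (1 * cmod (v k r)) + w k s * (cmod (u k r - u k s) * cmod (v k r))
          + w k s * (1 * cmod (v k r - v k s))"
      using w0[of s k] s u1 by (intro norm_triangle_mono) (auto simp: norm_mult simp del: of_real_diff)
    also have "\<dots> \<le> (2 * w k 0 * \<bar>r - s\<bar>) * (1 * M) + w k s * ((\<bar>\<alpha>\<bar> * \<bar>r - s\<bar>) * M)
          + w k s * (1 * (L * M * (if k = 0 then 1 else 1 / 4) * \<bar>r - s\<bar>))"
      using r s w0 du dv dw vM[of r k] by (intro add_mono mult_mono mult_left_mono) auto
    also have "\<dots> = b k" by (simp add: b_def algebra_simps)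
    finally show ?thesis .
  qed
  have ws: "(\<lambda>k. w k x) sums 1" if "x \<ge> 0" for x
    using digit_weight_sums[OF that] by (simp add: w_def)
  have bs: "b sums (2 * 1 * (M * \<bar>r - s\<bar>) + 1 * ((\<bar>\<alpha>\<bar> + L / 4) * M * \<bar>r - s\<bar>) + w 0 s * (3 / 4 * L * M * \<bar>r - s\<bar>))"
    unfolding b_def[abs_def] using s
    by (intro sums_add sums_mult2 sums_mult ws sums_single) auto
  have "twisted_transfer \<alpha> f r - twisted_transfer \<alpha> f s
      = (\<Sum>k. of_real (w k r) * u k r * v k r - of_real (w k s) * u k s * v k s)"
    unfolding twisted_transfer_def using summ[of r] summ[of s] r s
    by (subst suminf_diff[symmetric]) (auto simp: w_def u_def v_def)
  also have "cmod \<dots> \<le> suminf b"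
    using term_le bs by (intro norm_suminf_le) (auto simp: sums_iff)
  also have "\<dots> = 2 * 1 * (M * \<bar>r - s\<bar>) + 1 * ((\<bar>\<alpha>\<bar> + L / 4) * M * \<bar>r - s\<bar>) + w 0 s * (3 / 4 * L * M * \<bar>r - s\<bar>)"
    using bs by (simp add: sums_iff)
  also have "\<dots> \<le> 2 * 1 * (M * \<bar>r - s\<bar>) + 1 * ((\<bar>\<alpha>\<bar> + L / 4) * M * \<bar>r - s\<bar>) + 1 / 2 * (3 / 4 * L * M * \<bar>r - s\<bar>)"
  proof (intro add_left_mono mult_right_mono)
    have "w 0 s = 1 / (2 + s)" using s by (simp add: w_def digit_weight_def)
    also have "\<dots> \<le> 1 / 2" using s by (intro divide_left_mono) auto
    finally show "w 0 s \<le> 1 / 2" .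
  qed (use assms in auto)
  also have "\<dots> = (2 + \<bar>\<alpha>\<bar> + 5 / 8 * L) * M * \<bar>r - s\<bar>" by (simp add: algebra_simps)
  finally show ?thesis .
qed

text \<open>Digits are split at \<open>K\<close>. The head is bounded by its mass 1 - \<tau>. In the
  tail all branch points lie within \<open>1 / (real K + 1)\<close> of 0, so \<open>f\<close> may be
  replaced by \<open>f 0\<close> at the cost of the \<open>L\<close> term; what remains is a purely
  oscillating sum.\<close>

lemma twisted_transfer_sup:
  fixes K :: nat
  assumes f: "lipschitz_bounded L M f" and L: "0 \<le> L" and M: "0 \<le> M" and r: "r \<in> {0..1}"
  defines "\<tau> \<equiv> (1 + r) / (real K + 1 + r)"
  shows "cmod (twisted_transfer \<alpha> f r) \<le> M * (1 - \<tau> + \<tau> *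
     ((1 + (\<alpha>\<^sup>2 + \<bar>\<alpha>\<bar>) / (real K + 1)) / cmod (1 - \<i> * of_real \<alpha>) + L / (real K + 1)))"
proof -
  define C where "C = \<alpha>\<^sup>2 + \<bar>\<alpha>\<bar>"
  define w where "w k = digit_weight k r" for k
  define u where "u k = cis (\<alpha> * ln (real k + 1 + r))" for k
  define v where "v k = f (1 / (real k + 1 + r))" for k
  have r0: "0 \<le> r" using r by simp
  have w0: "w k \<ge> 0" for k by (simp add: w_def digit_weight_nonneg r0)
  have vM: "cmod (v k) \<le> M" for k
    using f inverse_shift_mem[OF r0, of k] by (auto simp: v_def lipschitz_bounded_def)
  have u1: "cmod (u k) = 1" for k by (simp add: u_def)
  have summ: "summable (\<lambda>k. of_real (w k) * u k * v k)"
    using summable_digit_weight_mult[OF r0, of "\<lambda>k. u k * v k" M] vM u1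
    by (simp add: norm_mult w_def mult.assoc)
  have summ': "summable (\<lambda>k. of_real (w k) * u k)"
    using summable_digit_weight_mult[OF r0, of u 1] u1 by (simp add: w_def)
  have wt: "(\<lambda>k. w (k + K)) sums \<tau>"
    using digit_weight_tail_sums[OF r0, of K] by (simp add: w_def \<tau>_def)
  have ws: "w sums 1" using digit_weight_sums[OF r0] by (simp add: w_def[abs_def])
  have wK: "(\<Sum>k<K. w k) = 1 - \<tau>"
    using suminf_split_initial_segment[of w K] ws wt by (auto simp: sums_iff)
  have split: "twisted_transfer \<alpha> f r = (\<Sum>k. of_real (w (k + K)) * u (k + K) * v (k + K)) + (\<Sum>k<K. of_real (w k) * u k * v k)"
    unfolding twisted_transfer_def using suminf_split_initial_segment[OF summ, of K]
    by (simp add: w_def u_def v_def)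
  have head: "cmod (\<Sum>k<K. of_real (w k) * u k * v k) \<le> M * (1 - \<tau>)"
  proof -
    have "cmod (\<Sum>k<K. of_real (w k) * u k * v k) \<le> (\<Sum>k<K. w k * M)"
      by (rule sum_norm_le) (auto simp: norm_mult u1 w0 vM intro!: mult_left_mono)
    then show ?thesis by (simp add: wK mult.commute flip: sum_distrib_left sum_distrib_right)
  qed
  have s1: "summable (\<lambda>k. of_real (w (k + K)) * u (k + K))"
    using summable_ignore_initial_segment[OF summ'] .
  have s2: "summable (\<lambda>k. of_real (w (k + K)) * u (k + K) * v (k + K))"
    using summable_ignore_initial_segment[OF summ] .
  have s3: "summable (\<lambda>k. of_real (w (k + K)) * u (k + K) * (v (k + K) - f 0))"
    using summable_diff[OF s2 summable_mult2[OF s1, of "f 0"]] by (simp add: algebra_simps)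
  have "(\<Sum>k. of_real (w (k + K)) * u (k + K) * v (k + K))
      = (\<Sum>k. of_real (w (k + K)) * u (k + K) * (v (k + K) - f 0) + of_real (w (k + K)) * u (k + K) * f 0)"
    by (simp add: algebra_simps)
  also have "\<dots> = (\<Sum>k. of_real (w (k + K)) * u (k + K) * (v (k + K) - f 0)) + (\<Sum>k. of_real (w (k + K)) * u (k + K)) * f 0"
    using s3 s1 by (subst suminf_add[symmetric]) (auto intro: summable_mult2 simp: suminf_mult2)
  also have "cmod \<dots> \<le> \<tau> * (L * M / (real K + 1)) + ((1 + C / (real K + 1)) * \<tau> / cmod (1 - \<i> * of_real \<alpha>)) * M"
  proof (rule norm_triangle_mono)
    have "cmod (\<Sum>k. of_real (w (k + K)) * u (k + K) * (v (k + K) - f 0)) \<le> (\<Sum>k. w (k + K) * (L * M / (real K + 1)))"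
    proof (rule norm_suminf_le)
      fix k
      have "cmod (v (k + K) - f 0) \<le> L * M * \<bar>1 / (real (k + K) + 1 + r) - 0\<bar>"
        unfolding v_def using f inverse_shift_mem[OF r0, of "k + K"]
        unfolding lipschitz_bounded_def by (metis atLeastAtMost_iff order_refl zero_le_one)
      also have "\<dots> = L * M / (real (k + K) + 1 + r)" using r0 by simp
      also have "\<dots> \<le> L * M / (real K + 1)"
        using r0 L M by (intro divide_left_mono) auto
      finally show "cmod (of_real (w (k + K)) * u (k + K) * (v (k + K) - f 0)) \<le> w (k + K) * (L * M / (real K + 1))"
        using w0[of "k + K"] mult_left_mono by (fastforce simp add: norm_mult u1 w0 simp del: times_divide_eq_right)
    qed (use wt in \<open>auto intro!: summable_mult2 summable_divide simp: sums_iff\<close>)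
    also have "\<dots> = \<tau> * (L * M / (real K + 1))"
      using sums_mult2[OF wt, of "L * M / (real K + 1)"] by (simp add: sums_iff)
    finally show "cmod (\<Sum>k. of_real (w (k + K)) * u (k + K) * (v (k + K) - f 0)) \<le> \<tau> * (L * M / (real K + 1))" .
  next
    have "cmod (1 - \<i> * of_real \<alpha>) > 0" by (simp add: complex_eq_iff)
    then have "cmod (\<Sum>k. of_real (w (k + K)) * u (k + K)) \<le> (1 + C / (real K + 1)) * \<tau> / cmod (1 - \<i> * of_real \<alpha>)"
      using digit_weight_oscillating_tail[OF r0, of \<alpha> K]
      unfolding w_def u_def C_def \<tau>_def by (subst pos_le_divide_eq) (simp_all only: mult.commute)
    moreover have "cmod (f 0) \<le> M" using f by (auto simp: lipschitz_bounded_def)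
    ultimately show "cmod ((\<Sum>k. of_real (w (k + K)) * u (k + K)) * f 0)
        \<le> (1 + C / (real K + 1)) * \<tau> / cmod (1 - \<i> * of_real \<alpha>) * M"
      unfolding norm_mult by (intro mult_mono) (auto simp: C_def \<tau>_def r0)
  qed
  finally have "cmod (twisted_transfer \<alpha> f r) \<le>
     (\<tau> * (L * M / (real K + 1)) + ((1 + C / (real K + 1)) * \<tau> / cmod (1 - \<i> * of_real \<alpha>)) * M) + M * (1 - \<tau>)"
    unfolding split using head by (rule norm_triangle_mono)
  then show ?thesis by (simp add: C_def algebra_simps)
qed

text \<open>The constants are chosen in order: \<open>L\<close> makes the Lipschitz estimate close,
  then \<open>K\<close>, depending on \<open>L\<close>, makes the bracket of the supremum estimate
  less than 1. The latter is possible because \<alpha> \<noteq> 0 forces \<bar>1 - \<i>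
  \<alpha>\<bar> > 1.\<close>

lemma twisted_transfer_contraction:
  assumes "\<alpha> \<noteq> 0"
  obtains \<rho> L where "0 \<le> \<rho>" "\<rho> < 1" "0 \<le> L"
    "\<And>M f. 0 \<le> M \<Longrightarrow> lipschitz_bounded L M f \<Longrightarrow> lipschitz_bounded L (\<rho> * M) (twisted_transfer \<alpha> f)"
proof -
  \<comment> \<open>The slack (3/4 - 5/8) \<open>L\<close> = 2 + 2 \<bar>\<alpha>\<bar> absorbs the
    term 2 + \<bar>\<alpha>\<bar> of the Lipschitz estimate.\<close>
  define L where "L = 16 + 16 * \<bar>\<alpha>\<bar>"
  define C where "C = \<alpha>\<^sup>2 + \<bar>\<alpha>\<bar>"
  define \<beta> where "\<beta> = cmod (1 - \<i> * of_real \<alpha>)"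
  define \<eta> where "\<eta> K = (1 + C / (real K + 1)) / \<beta> + L / (real K + 1)" for K :: nat
  have L: "L \<ge> 0" by (simp add: L_def)
  have \<beta>: "\<beta> > 1"
  proof -
    have "\<beta> = sqrt (1 + \<alpha>\<^sup>2)" by (simp add: \<beta>_def cmod_def)
    then show ?thesis using assms by simp
  qed
  have "\<eta> \<longlonglongrightarrow> (1 + 0) / \<beta> + 0"
    unfolding \<eta>_def using \<beta> by (intro tendsto_intros; (simp; fail)?; real_asymp)
  moreover have "(1 + 0) / \<beta> + 0 < 1" using \<beta> by simp
  ultimately have "\<forall>\<^sub>F K in sequentially. \<eta> K < 1" by (rule order_tendstoD(2))
  then obtain K where K: "\<eta> K < 1" by (auto simp: eventually_sequentially)
  define \<rho> where "\<rho> = max (3 / 4) (1 - (1 - \<eta> K) / (real K + 1))"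
  show thesis
  proof (rule that)
    show "0 \<le> \<rho>" by (simp add: \<rho>_def)
    show "\<rho> < 1" using K by (simp add: \<rho>_def)
    show "0 \<le> L" by fact
    fix M f assume M: "0 \<le> M" and f: "lipschitz_bounded L M f"
    show "lipschitz_bounded L (\<rho> * M) (twisted_transfer \<alpha> f)"
      unfolding lipschitz_bounded_def
    proof (intro conjI ballI)
      fix r :: real assume r: "r \<in> {0..1}"
      define \<tau> where "\<tau> = (1 + r) / (real K + 1 + r)"
      \<comment> \<open>The tail mass is bounded below independently of \<open>r\<close>, which
        makes the gain uniform.\<close>
      have "1 / (real K + 1) \<le> \<tau>" using r by (simp add: field_simps \<tau>_def)
      then have "(1 - \<eta> K) * (1 / (real K + 1)) \<le> (1 - \<eta> K) * \<tau>" using K by (intro mult_left_mono) auto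
      moreover have "1 - (1 - \<eta> K) / (real K + 1) \<le> \<rho>" by (simp add: \<rho>_def)
      ultimately have "1 - \<tau> + \<tau> * \<eta> K \<le> \<rho>" by (simp add: algebra_simps)
      then have "M * (1 - \<tau> + \<tau> * \<eta> K) \<le> M * \<rho>" using M by (rule mult_left_mono)
      with twisted_transfer_sup[OF f L M r, of \<alpha> K] show "cmod (twisted_transfer \<alpha> f r) \<le> \<rho> * M"
        by (simp add: \<eta>_def C_def \<beta>_def \<tau>_def mult.commute)
    next
      fix r s :: real assume rs: "r \<in> {0..1}" "s \<in> {0..1}"
      have "2 + \<bar>\<alpha>\<bar> + 5 / 8 * L \<le> 3 / 4 * L" by (simp add: L_def)
      also have "\<dots> \<le> \<rho> * L" using L by (intro mult_right_mono) (auto simp: \<rho>_def)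
      finally have "(2 + \<bar>\<alpha>\<bar> + 5 / 8 * L) * M * \<bar>r - s\<bar> \<le> (\<rho> * L) * M * \<bar>r - s\<bar>"
        using M by (intro mult_right_mono) auto
      with twisted_transfer_lipschitz[OF f L M rs, of \<alpha>]
      show "cmod (twisted_transfer \<alpha> f r - twisted_transfer \<alpha> f s) \<le> L * (\<rho> * M) * \<bar>r - s\<bar>"
        by (simp add: mult_ac)
    qed
  qed
qed

section \<open>Correlations of the denominators\<close>

definition cylinder_density :: "real \<Rightarrow> real \<Rightarrow> real" where
  "cylinder_density r t = (1 + r) / (1 + r * t)\<^sup>2"

definition cylinder_mean :: "real \<Rightarrow> (real \<Rightarrow> complex) \<Rightarrow> complex" where
  "cylinder_mean r F = integral {0<..<1} (\<lambda>t. cylinder_density r t *\<^sub>R F t)"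

text \<open>For irrational \<open>t\<close> in the unit interval and \<open>r \<ge> 0\<close> this
  is the logarithm of \<open>q\<^sub>n + r p\<^sub>n\<close>. The case \<open>r = 0\<close> is the
  one of interest; a free \<open>r\<close> lets the recursion consume digits from the front, along
  the Gauss map.\<close>

fun log_denom :: "nat \<Rightarrow> real \<Rightarrow> real \<Rightarrow> real" where
  "log_denom 0 r t = 0"
| "log_denom (Suc n) r t =
     ln (of_int \<lfloor>1 / t\<rfloor> + r) + log_denom n (1 / (of_int \<lfloor>1 / t\<rfloor> + r)) (gauss_map t)"

text \<open>Measurability has to be joint, because the recursion replaces \<open>r\<close> by a
  value that depends on \<open>t\<close>.\<close>

lemma measurable_log_denom_pair:
  "(\<lambda>p. log_denom n (fst p) (snd p)) \<in> borel_measurable (borel \<Otimes>\<^sub>M borel)"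
proof (induction n)
  case (Suc n)
  have "(\<lambda>p. (1 / (of_int \<lfloor>1 / snd p\<rfloor> + fst p), gauss_map (snd p)))
          \<in> (borel \<Otimes>\<^sub>M borel :: (real \<times> real) measure) \<rightarrow>\<^sub>M borel \<Otimes>\<^sub>M borel"
    unfolding gauss_map_def by measurable
  from measurable_compose[OF this Suc.IH] have [measurable]:
    "(\<lambda>p. log_denom n (1 / (of_int \<lfloor>1 / snd p\<rfloor> + fst p)) (gauss_map (snd p)))
       \<in> borel_measurable (borel \<Otimes>\<^sub>M borel :: (real \<times> real) measure)"
    by simp
  show ?case by simp
qed simp

lemma measurable_log_denom [measurable]: "log_denom n r \<in> borel_measurable borel"
proof -
  have "(\<lambda>t::real. (r, t)) \<in> borel \<rightarrow>\<^sub>M borel \<Otimes>\<^sub>M borel" by measurable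
  from measurable_compose[OF this measurable_log_denom_pair[of n]] show ?thesis by simp
qed

section \<open>Cylinder densities and the branches of the Gauss map\<close>

lemma cylinder_density_bounds:
  assumes "r \<in> {0..1}" "t \<in> {0..1}"
  shows "0 \<le> cylinder_density r t" "cylinder_density r t \<le> 2"
proof -
  have "1 + r * t \<ge> 1" using assms by simp
  then have "(1 + r * t)\<^sup>2 \<ge> 1" using one_le_power by blast
  then have "(1 + r) / (1 + r * t)\<^sup>2 \<le> 2 / 1" using assms by (intro frac_le) auto
  then show "cylinder_density r t \<le> 2" by (simp add: cylinder_density_def)
  show "0 \<le> cylinder_density r t" using assms by (simp add: cylinder_density_def)
qed

lemma cylinder_integrable:
  assumes [measurable]: "F \<in> borel_measurable borel" and "\<And>t. cmod (F t) \<le> B" and r: "r \<in> {0..1}"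
  shows "(\<lambda>t. cylinder_density r t *\<^sub>R F t) absolutely_integrable_on {0<..<1}"
proof (rule measurable_bounded_by_integrable_imp_absolutely_integrable)
  have "(\<lambda>t. cylinder_density r t *\<^sub>R F t) \<in> borel_measurable borel"
    unfolding cylinder_density_def by measurable
  then have "(\<lambda>t. cylinder_density r t *\<^sub>R F t) \<in> borel_measurable lebesgue"
    by (simp add: measurable_completion)
  then show "(\<lambda>t. cylinder_density r t *\<^sub>R F t) \<in> borel_measurable (lebesgue_on {0<..<1})"
    by (rule measurable_restrict_space1)
  show "(\<lambda>t. 2 * B) integrable_on {0<..<1::real}"
    by (subst integrable_on_open_interval_real) (rule integrable_const_ivl)
  show "norm (cylinder_density r t *\<^sub>R F t) \<le> 2 * B" if "t \<in> {0<..<1}" for t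
    using that cylinder_density_bounds[OF r, of t] assms(2)[of t] by (auto intro!: mult_mono)
qed auto

text \<open>The Markov property at the level of densities: after substitution with its Jacobian, the
  density factors into the probability of the branch and the density for the new ratio. Both sides
  equal \<open>(1 + r) / (k + 1 + r + s)\<^sup>2\<close>.\<close>

lemma cylinder_density_branch:
  assumes r: "r \<in> {0..1}" and s: "s \<in> {0<..<1}"
  shows "1 / (real k + 1 + s)\<^sup>2 * cylinder_density r (1 / (real k + 1 + s))
    = digit_weight k r * cylinder_density (1 / (real k + 1 + r)) s"
proof -
  define a where "a = real k + 1"
  have a: "a \<ge> 1" by (simp add: a_def)
  have nz: "a + s \<noteq> 0" "a + r \<noteq> 0" "a + r + s \<noteq> 0" "a + r + 1 \<noteq> 0" using a r s by auto
  have "1 + r * (1 / (a + s)) = (a + r + s) / (a + s)" using nz by (simp add: field_simps)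
  then have 1: "1 / (a + s)\<^sup>2 * cylinder_density r (1 / (a + s)) = (1 + r) / (a + r + s)\<^sup>2"
    using nz by (simp add: cylinder_density_def power_divide)
  have "1 + 1 / (a + r) * s = (a + r + s) / (a + r)" "1 + 1 / (a + r) = (a + r + 1) / (a + r)"
    using nz by (simp_all add: field_simps)
  then have "cylinder_density (1 / (a + r)) s = (a + r + 1) * (a + r) / (a + r + s)\<^sup>2"
    using nz by (simp add: cylinder_density_def power_divide power2_eq_square)
  moreover have "digit_weight k r = (1 + r) / ((a + r) * (a + r + 1))"
    by (simp add: digit_weight_def a_def add_ac)
  ultimately have "digit_weight k r * cylinder_density (1 / (a + r)) s = (1 + r) / (a + r + s)\<^sup>2"
    using nz by simp
  with 1 show ?thesis by (simp add: a_def)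
qed

lemma branch_image:
  "(\<lambda>s. 1 / (real k + 1 + s)) ` {0<..<1} = {1 / (real k + 2)<..<1 / (real k + 1)}"
proof (intro equalityI subsetI)
  fix t assume "t \<in> {1 / (real k + 2)<..<1 / (real k + 1)}"
  then have t: "1 / (real k + 2) < t" "t < 1 / (real k + 1)" by auto
  then have t0: "t > 0" by (smt (verit) divide_pos_pos of_nat_0_le_iff)
  have "1 / t < real k + 2" "real k + 1 < 1 / t" using t t0 by (simp_all add: field_simps)
  then have "1 / t - real k - 1 \<in> {0<..<1}" by auto
  moreover have "t = 1 / (real k + 1 + (1 / t - real k - 1))" using t0 by simp
  ultimately show "t \<in> (\<lambda>s. 1 / (real k + 1 + s)) ` {0<..<1}" by blast
qed (auto intro!: divide_strict_left_mono mult_pos_pos)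

lemma branch_digit:
  assumes "s \<in> {0<..<1}"
  shows "\<lfloor>1 / (1 / (real k + 1 + s))\<rfloor> = int k + 1" "gauss_map (1 / (real k + 1 + s)) = s"
proof -
  show "\<lfloor>1 / (1 / (real k + 1 + s))\<rfloor> = int k + 1" using assms by (simp add: floor_eq_iff)
  then show "gauss_map (1 / (real k + 1 + s)) = s" by (simp add: gauss_map_def)
qed

text \<open>Only endpoints are missed. They form a countable, hence negligible, set, so integrals
  may be split over the open branches.\<close>

lemma unit_interval_branches:
  "{0<..<1::real} - (\<Union>k. {1 / (real k + 2)<..<1 / (real k + 1)}) \<subseteq> range (\<lambda>k::nat. 1 / real k)"
proof
  fix t :: real assume t: "t \<in> {0<..<1} - (\<Union>k. {1 / (real k + 2)<..<1 / (real k + 1)})"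
  define k where "k = nat (\<lfloor>1 / t\<rfloor> - 1)"
  have "1 / t > 1" using t by simp
  then have "\<lfloor>1 / t\<rfloor> \<ge> 1" by simp
  then have k: "real k = of_int \<lfloor>1 / t\<rfloor> - 1" by (simp add: k_def)
  have "1 / t < real k + 2" "real k + 1 \<le> 1 / t" unfolding k by linarith+
  then have "1 / (real k + 2) < t" "t \<le> 1 / (real k + 1)" using t by (auto simp: field_simps)
  with t have "t = 1 / (real (Suc k))" by (force simp: add.commute)
  then show "t \<in> range (\<lambda>k::nat. 1 / real k)" by blast
qed

lemma disjoint_branches:
  assumes "i \<noteq> j"
  shows "{1 / (real i + 2)<..<1 / (real i + 1)} \<inter> {1 / (real j + 2)<..<1 / (real j + 1)} = {}"
proof -
  have *: "{1 / (real i + 2)<..<1 / (real i + 1)} \<inter> {1 / (real j + 2)<..<1 / (real j + 1)} = {}"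
    if "i < j" for i j :: nat
  proof -
    have "1 / (real j + 1) \<le> 1 / (real i + 2)" using that by (intro divide_left_mono) auto
    then show ?thesis by auto
  qed
  from assms consider "i < j" | "j < i" by linarith
  then show ?thesis using *[of i j] *[of j i] by cases auto
qed

text \<open>Substituting \<open>t = 1 / (k + 1 + s)\<close> on each branch of the Gauss map gives the Markov property.\<close>

lemma cylinder_mean_branches:
  assumes F: "F \<in> borel_measurable borel" "\<And>t. cmod (F t) \<le> B" and r: "r \<in> {0..1}"
  shows "cylinder_mean r F = (\<Sum>k. of_real (digit_weight k r) *
           cylinder_mean (1 / (real k + 1 + r)) (\<lambda>s. F (1 / (real k + 1 + s))))"
proof -
  define f where "f t = cylinder_density r t *\<^sub>R F t" for t
  define A where "A k = {1 / (real k + 2)<..<1 / (real k + 1)}" for k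
  have sub: "A k \<subseteq> {0<..<1}" for k
  proof
    fix t assume "t \<in> A k"
    moreover have "1 / (real k + 1) \<le> 1" "0 < 1 / (real k + 2)" by auto
    ultimately show "t \<in> {0<..<1}"
      unfolding A_def greaterThanLessThan_iff by linarith
  qed
  have f: "f absolutely_integrable_on {0<..<1}"
    unfolding f_def using F r by (rule cylinder_integrable)
  have Am: "A k \<in> sets lebesgue" for k by (simp add: A_def)
  have fA: "f absolutely_integrable_on A k" for k
    using set_integrable_subset[OF f Am sub] .
  have fU: "f absolutely_integrable_on (\<Union>k. A k)"
    using Am sub by (intro set_integrable_subset[OF f]) auto
  have neg: "negligible ({0<..<1} - (\<Union>k. A k))"
    unfolding A_def
    by (rule negligible_subset[OF _ unit_interval_branches])
      (simp add: negligible_iff_null_sets null_sets_completionI countable_imp_null_set_lborel)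
  have "cylinder_mean r F = integral {0<..<1} f" by (simp add: cylinder_mean_def f_def[abs_def])
  also have "\<dots> = integral (\<Union>k. A k) f"
  proof (rule integral_spike_set)
    show "negligible {x \<in> {0<..<1} - (\<Union>k. A k). f x \<noteq> 0}"
      by (rule negligible_subset[OF neg]) auto
    show "negligible {x \<in> (\<Union>k. A k) - {0<..<1}. f x \<noteq> 0}"
      by (rule negligible_subset[OF negligible_empty]) (use sub in blast)
  qed
  also have "\<dots> = (LINT t:(\<Union>k. A k)|lebesgue. f t)"
    using set_lebesgue_integral_eq_integral(2)[OF fU] by simp
  also have "\<dots> = (\<Sum>k. LINT t:A k|lebesgue. f t)"
    using Am disjoint_branches fU by (intro lebesgue_integral_countable_add) (auto simp: A_def)
  also have "\<dots> = (\<Sum>k. of_real (digit_weight k r) *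
           cylinder_mean (1 / (real k + 1 + r)) (\<lambda>s. F (1 / (real k + 1 + s))))"
  proof (rule suminf_cong)
    fix k
    let ?g = "\<lambda>s. 1 / (real k + 1 + s)"
    let ?h = "\<lambda>s. - (1 / (real k + 1 + s)\<^sup>2)"
    have "(LINT t:A k|lebesgue. f t) = integral (A k) f"
      using set_lebesgue_integral_eq_integral(2)[OF fA] .
    \<comment> \<open>Change of variables is available as an equivalence; its right-hand side holds
      by \<open>fA\<close> and \<open>branch_image\<close>, and the left-hand side gives the
      equation.\<close>
    also have "\<dots> = integral {0<..<1} (\<lambda>s. \<bar>?h s\<bar> *\<^sub>R f (?g s))"
    proof -
      have "(\<lambda>s. \<bar>?h s\<bar> *\<^sub>R f (?g s)) absolutely_integrable_on {0<..<1} \<and>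
            integral {0<..<1} (\<lambda>s. \<bar>?h s\<bar> *\<^sub>R f (?g s)) = integral (A k) f
          \<longleftrightarrow> f absolutely_integrable_on ?g ` {0<..<1} \<and> integral (?g ` {0<..<1}) f = integral (A k) f"
      proof (rule has_absolute_integral_change_of_variables_real)
        show "(?g has_field_derivative ?h s) (at s within {0<..<1})" if "s \<in> {0<..<1}" for s
          using that by (auto intro!: derivative_eq_intros simp: power2_eq_square)
        show "inj_on ?g {0<..<1}" by (auto intro!: inj_onI)
      qed auto
      then show ?thesis using fA by (simp add: branch_image A_def)
    qed
    also have "\<dots> = integral {0<..<1} (\<lambda>s. digit_weight k r *\<^sub>R (cylinder_density (1 / (real k + 1 + r)) s *\<^sub>R F (?g s)))"
    proof (rule integral_cong)
      fix s :: real assume "s \<in> {0<..<1}"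
      from cylinder_density_branch[OF r this, of k]
      show "\<bar>?h s\<bar> *\<^sub>R f (?g s) = digit_weight k r *\<^sub>R (cylinder_density (1 / (real k + 1 + r)) s *\<^sub>R F (?g s))"
        unfolding f_def scaleR_scaleR by simp
    qed
    also have "\<dots> = of_real (digit_weight k r) * cylinder_mean (1 / (real k + 1 + r)) (\<lambda>s. F (?g s))"
      by (simp only: cylinder_mean_def Henstock_Kurzweil_Integration.integral_cmul)
        (simp add: scaleR_conv_of_real)
    finally show "(LINT t:A k|lebesgue. f t) = \<dots>" .
  qed
  finally show ?thesis .
qed

text \<open>The density has antiderivative \<open>(1 + r) * t / (1 + r * t)\<close>. This
  normalisation starts the induction for the decay of correlations.\<close>

lemma cylinder_mean_one:
  assumes "r \<in> {0..1}"
  shows "cylinder_mean r (\<lambda>_. 1) = 1"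
proof -
  have pos: "1 + r * t > 0" if "t \<in> {0..1}" for t using that assms by (simp add: add_pos_nonneg)
  have "(cylinder_density r has_integral (1 + r) * 1 / (1 + r * 1) - (1 + r) * 0 / (1 + r * 0)) {0..1}"
  proof (rule fundamental_theorem_of_calculus)
    fix t :: real assume t: "t \<in> {0..1}"
    show "((\<lambda>t. (1 + r) * t / (1 + r * t)) has_vector_derivative cylinder_density r t) (at t within {0..1})"
      unfolding has_real_derivative_iff_has_vector_derivative[symmetric] cylinder_density_def
      using pos[OF t] by (auto intro!: derivative_eq_intros simp: power2_eq_square) (simp add: field_simps)
  qed simp
  then have "(cylinder_density r has_integral 1) {0..1}" using assms by simp
  then have "(cylinder_density r has_integral 1) {0<..<1}"
    by (subst (asm) has_integral_Icc_iff_Ioo)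
  then have "((\<lambda>t. of_real (cylinder_density r t)) has_integral (of_real 1 :: complex)) {0<..<1}"
    by (rule has_integral_of_real)
  then show ?thesis
    unfolding cylinder_mean_def by (simp add: scaleR_conv_of_real integral_unique)
qed

text \<open>The correlation of the phases of the \<open>m\<close>-th and \<open>n\<close>-th
  denominators, seen as a function of the starting ratio \<open>r\<close> on which the transition
  operators act.\<close>

definition phase_mean :: "real \<Rightarrow> nat \<Rightarrow> nat \<Rightarrow> real \<Rightarrow> complex" where
  "phase_mean \<alpha> m n r = cylinder_mean r (\<lambda>t. cis (\<alpha> * (log_denom n r t - log_denom m r t)))"

lemma cylinder_mean_cong:
  "(\<And>t. t \<in> {0<..<1} \<Longrightarrow> F t = G t) \<Longrightarrow> cylinder_mean r F = cylinder_mean r G"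
  unfolding cylinder_mean_def by (intro integral_cong) auto

lemma measurable_phase [measurable]:
  "(\<lambda>t. cis (\<alpha> * (log_denom n r t - log_denom m r t))) \<in> borel_measurable borel"
proof -
  have "(\<lambda>t. \<alpha> * (log_denom n r t - log_denom m r t)) \<in> borel_measurable borel" by measurable
  moreover have "cis \<in> borel_measurable borel"
    by (intro borel_measurable_continuous_onI continuous_intros)
  ultimately show ?thesis by (rule measurable_compose)
qed

text \<open>Both logarithms begin with the same summand, which cancels, so the step is a plain
  average without phase.\<close>

lemma phase_mean_Suc_Suc:
  assumes "r \<in> {0..1}"
  shows "phase_mean \<alpha> (Suc m) (Suc n) r =
    (\<Sum>k. of_real (digit_weight k r) * phase_mean \<alpha> m n (1 / (real k + 1 + r)))"
  unfolding phase_mean_def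
  by (subst cylinder_mean_branches[OF measurable_phase _ assms, where B = 1])
    (auto intro!: suminf_cong arg_cong2[where f = times] cylinder_mean_cong simp: branch_digit simp del: divide_divide_eq_right)

text \<open>Here nothing cancels: the first summand \<open>ln (real k + 1 + r)\<close> is exactly
  the phase of the twisted operator.\<close>

lemma phase_mean_0_Suc:
  assumes "r \<in> {0..1}"
  shows "phase_mean \<alpha> 0 (Suc n) r = twisted_transfer \<alpha> (phase_mean \<alpha> 0 n) r"
proof -
  have "phase_mean \<alpha> 0 (Suc n) r = (\<Sum>k. of_real (digit_weight k r) *
     cylinder_mean (1 / (real k + 1 + r)) (\<lambda>s. cis (\<alpha> * (log_denom (Suc n) r (1 / (real k + 1 + s)) - log_denom 0 r (1 / (real k + 1 + s))))))"
    unfolding phase_mean_def by (rule cylinder_mean_branches[OF measurable_phase _ assms, where B = 1]) simp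
  also have "\<dots> = (\<Sum>k. of_real (digit_weight k r) * (cis (\<alpha> * ln (real k + 1 + r)) * phase_mean \<alpha> 0 n (1 / (real k + 1 + r))))"
  proof (intro suminf_cong arg_cong2[where f = times] refl)
    fix k
    have "cylinder_mean (1 / (real k + 1 + r)) (\<lambda>s. cis (\<alpha> * (log_denom (Suc n) r (1 / (real k + 1 + s)) - log_denom 0 r (1 / (real k + 1 + s)))))
      = cylinder_mean (1 / (real k + 1 + r)) (\<lambda>s. cis (\<alpha> * ln (real k + 1 + r)) * cis (\<alpha> * (log_denom n (1 / (real k + 1 + r)) s - log_denom 0 (1 / (real k + 1 + r)) s)))"
      by (rule cylinder_mean_cong)
        (simp add: branch_digit cis_mult distrib_left del: divide_divide_eq_right)
    then show "cylinder_mean (1 / (real k + 1 + r)) (\<lambda>s. cis (\<alpha> * (log_denom (Suc n) r (1 / (real k + 1 + s)) - log_denom 0 r (1 / (real k + 1 + s)))))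
      = cis (\<alpha> * ln (real k + 1 + r)) * phase_mean \<alpha> 0 n (1 / (real k + 1 + r))"
      by (simp add: cylinder_mean_def phase_mean_def flip: mult_scaleR_right)
  qed
  finally show ?thesis by (simp add: twisted_transfer_def mult.assoc)
qed

text \<open>From the constant 1, \<open>n\<close> twisted steps each gain the factor \<rho>; the
  \<open>m\<close> remaining steps are averages and preserve the supremum bound. Lipschitz control
  is needed for the twisted steps only.\<close>

lemma phase_mean_decay:
  assumes "\<alpha> \<noteq> 0"
  obtains \<rho> where "0 \<le> \<rho>" "\<rho> < 1"
    "\<And>m n r. r \<in> {0..1} \<Longrightarrow> cmod (phase_mean \<alpha> m (m + n) r) \<le> \<rho> ^ n"
proof -
  obtain \<rho> L where \<rho>: "0 \<le> \<rho>" "\<rho> < 1" "0 \<le> L" and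
    contr: "\<And>M f. 0 \<le> M \<Longrightarrow> lipschitz_bounded L M f \<Longrightarrow> lipschitz_bounded L (\<rho> * M) (twisted_transfer \<alpha> f)"
    using twisted_transfer_contraction[OF assms] by metis
  have lb: "lipschitz_bounded L (\<rho> ^ n) (phase_mean \<alpha> 0 n)" for n
  proof (induction n)
    case 0
    show ?case using \<rho> by (simp add: lipschitz_bounded_def phase_mean_def cylinder_mean_one)
  next
    case (Suc n)
    from contr[OF _ this] \<rho> show ?case by (simp add: lipschitz_bounded_def phase_mean_0_Suc)
  qed
  have "cmod (phase_mean \<alpha> m (m + n) r) \<le> \<rho> ^ n" if "r \<in> {0..1}" for m n r
    using that
  proof (induction m arbitrary: r)
    case 0
    then show ?case using lb[of n] by (simp add: lipschitz_bounded_def)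
  next
    case (Suc m)
    have "cmod (phase_mean \<alpha> m (m + n) (1 / (real k + 1 + r))) \<le> \<rho> ^ n" for k
      using Suc.IH inverse_shift_mem[of r k] Suc.prems by simp
    then show ?case using Suc.prems
      by (simp add: phase_mean_Suc_Suc cmod_digit_weight_sum_le)
  qed
  with \<rho> show thesis by (intro that) auto
qed

section \<open>Almost sure convergence from mean square bounds\<close>

text \<open>Past \<open>j\<^sup>2\<close> and before the next square there are at most
  \<open>2 * j\<close> further indices, which is negligible against
  \<open>j\<^sup>2\<close>.\<close>

lemma averages_tendsto_0_of_squares:
  fixes z :: "nat \<Rightarrow> complex"
  assumes z: "\<And>n. cmod (z n) \<le> 1"
    and sq: "(\<lambda>j. cmod (\<Sum>n=1..j\<^sup>2. z n) / real (j\<^sup>2)) \<longlonglongrightarrow> 0"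
  shows "(\<lambda>N. (\<Sum>n=1..N. z n) / of_nat N) \<longlonglongrightarrow> 0"
proof -
  define b where "b j = cmod (\<Sum>n=1..j\<^sup>2. z n) / real (j\<^sup>2) + 2 / real j" for j
  have "b \<longlonglongrightarrow> 0 + 0" unfolding b_def by (intro tendsto_add sq) real_asymp
  moreover have "filterlim floor_sqrt at_top sequentially"
    unfolding filterlim_at_top
    by (intro allI eventually_sequentiallyI[of "_ ^ 2"]) (simp add: le_floor_sqrt_iff)
  ultimately have lim: "(\<lambda>N. b (floor_sqrt N)) \<longlonglongrightarrow> 0"
    using filterlim_compose by force
  show ?thesis
  proof (rule Lim_null_comparison[OF eventually_sequentiallyI lim])
    fix N :: nat assume N: "1 \<le> N"
    define j where "j = floor_sqrt N"
    have j: "j \<ge> 1" using N by (simp add: j_def Suc_le_eq)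
    have jN: "j\<^sup>2 \<le> N" by (simp add: j_def)
    have "N < (Suc j)\<^sup>2" unfolding j_def by (rule Suc_floor_sqrt_power2_gt)
    then have gap: "N - j\<^sup>2 \<le> 2 * j" by (simp add: power2_eq_square)
    have "{1..N} = {1..j\<^sup>2} \<union> {j\<^sup>2<..N}" using jN by auto
    then have "(\<Sum>n=1..N. z n) = (\<Sum>n=1..j\<^sup>2. z n) + (\<Sum>n\<in>{j\<^sup>2<..N}. z n)"
      by (simp only:) (rule sum.union_disjoint, auto)
    also have "cmod \<dots> \<le> cmod (\<Sum>n=1..j\<^sup>2. z n) + (\<Sum>n\<in>{j\<^sup>2<..N}. 1)"
      by (intro norm_triangle_mono order.refl sum_norm_le) (rule z)
    also have "\<dots> \<le> cmod (\<Sum>n=1..j\<^sup>2. z n) + 2 * real j" using gap by simp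
    finally have "cmod (\<Sum>n=1..N. z n) / real N \<le> (cmod (\<Sum>n=1..j\<^sup>2. z n) + 2 * real j) / real N"
      by (rule divide_right_mono) simp
    also have "\<dots> \<le> (cmod (\<Sum>n=1..j\<^sup>2. z n) + 2 * real j) / real (j\<^sup>2)"
      using j jN N by (intro divide_left_mono mult_pos_pos) (auto simp flip: of_nat_power)
    also have "\<dots> = b j" using j by (simp add: b_def add_divide_distrib power2_eq_square)
    finally show "cmod ((\<Sum>n=1..N. z n) / of_nat N) \<le> b (floor_sqrt N)"
      by (simp add: norm_divide j_def)
  qed
qed

text \<open>Along squares the averages have mean square of order \<open>1 / j\<^sup>2\<close>, which
  is summable. Hence the series of their squares is finite almost everywhere and its terms tend to
  0; the gaps between squares are filled deterministically.\<close>

lemma (in finite_measure) AE_averages_tendsto_0: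
  fixes z :: "nat \<Rightarrow> 'a \<Rightarrow> complex"
  assumes meas [measurable]: "\<And>n. z n \<in> borel_measurable M"
    and bound: "\<And>n x. cmod (z n x) \<le> 1"
    and L2: "\<And>N. (\<integral>x. (cmod (\<Sum>n=1..N. z n x))\<^sup>2 \<partial>M) \<le> C * real N"
  shows "AE x in M. (\<lambda>N. (\<Sum>n=1..N. z n x) / of_nat N) \<longlonglongrightarrow> 0"
proof -
  define f where "f j x = (cmod (\<Sum>n=1..(Suc j)\<^sup>2. z n x) / real ((Suc j)\<^sup>2))\<^sup>2" for j x
  have f_meas [measurable]: "f j \<in> borel_measurable M" for j unfolding f_def by measurable
  have sum_le: "cmod (\<Sum>n=1..N. z n x) \<le> real N" for N x
    using sum_norm_le[of "{1..N}" "\<lambda>n. z n x" "\<lambda>_. 1"] bound by simp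
  have f_int: "integrable M (f j)" for j
  proof (rule integrable_const_bound[where B = 1])
    have "cmod (\<Sum>n=1..(Suc j)\<^sup>2. z n x) / real ((Suc j)\<^sup>2) \<le> 1" for x
      using sum_le[where N = "(Suc j)\<^sup>2" and x = x] by (subst divide_le_eq_1) auto
    then show "AE x in M. norm (f j x) \<le> 1"
      by (auto simp: f_def power_le_one simp del: of_nat_power power_divide)
  qed measurable
  have f_le: "(\<integral>x. f j x \<partial>M) \<le> \<bar>C\<bar> / (real (Suc j))\<^sup>2" for j
  proof -
    let ?N = "(Suc j)\<^sup>2"
    have "(\<integral>x. f j x \<partial>M) = (\<integral>x. (cmod (\<Sum>n=1..?N. z n x))\<^sup>2 / (real ?N)\<^sup>2 \<partial>M)"
      by (simp add: f_def power_divide)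
    also have "\<dots> = (\<integral>x. (cmod (\<Sum>n=1..?N. z n x))\<^sup>2 \<partial>M) / (real ?N)\<^sup>2" by simp
    also have "\<dots> \<le> (C * real ?N) / (real ?N)\<^sup>2"
      by (intro divide_right_mono L2) simp
    also have "\<dots> = C / real ?N" by (simp add: power2_eq_square)
    also have "\<dots> \<le> \<bar>C\<bar> / real ?N" by (intro divide_right_mono) auto
    finally show ?thesis by simp
  qed
  have "summable (\<lambda>j. \<bar>C\<bar> * (1 / (real (Suc j))\<^sup>2))"
    by (intro summable_mult) (use inverse_squares_sums in \<open>auto simp: sums_iff add.commute\<close>)
  then have top: "(\<Sum>j. ennreal (\<bar>C\<bar> / (real (Suc j))\<^sup>2)) \<noteq> top"
    by (intro ennreal_suminf_neq_top) auto
  have "(\<integral>\<^sup>+x. (\<Sum>j. ennreal (f j x)) \<partial>M) = (\<Sum>j. \<integral>\<^sup>+x. ennreal (f j x) \<partial>M)"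
    by (intro nn_integral_suminf) measurable
  also have "\<dots> \<le> (\<Sum>j. ennreal (\<bar>C\<bar> / (real (Suc j))\<^sup>2))"
  proof (rule suminf_le)
    fix j
    have "(\<integral>\<^sup>+x. ennreal (f j x) \<partial>M) = ennreal (\<integral>x. f j x \<partial>M)"
      by (rule nn_integral_eq_integral[OF f_int]) (auto simp: f_def)
    then show "(\<integral>\<^sup>+x. ennreal (f j x) \<partial>M) \<le> ennreal (\<bar>C\<bar> / (real (Suc j))\<^sup>2)"
      using ennreal_leI[OF f_le[of j]] by simp
  qed auto
  finally have "(\<integral>\<^sup>+x. (\<Sum>j. ennreal (f j x)) \<partial>M) \<noteq> \<infinity>"
    using top by (auto simp: top_unique)
  then have "AE x in M. (\<Sum>j. ennreal (f j x)) \<noteq> \<infinity>"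
    by (intro nn_integral_PInf_AE) measurable
  then show ?thesis
  proof (rule AE_mp, intro AE_I2 impI)
    fix x assume "(\<Sum>j. ennreal (f j x)) \<noteq> \<infinity>"
    then have "summable (\<lambda>j. f j x)" by (intro summable_suminf_not_top) (auto simp: f_def)
    then have "(\<lambda>j. f j x) \<longlonglongrightarrow> 0" by (rule summable_LIMSEQ_zero)
    then have "(\<lambda>j. sqrt (f j x)) \<longlonglongrightarrow> sqrt 0" by (rule tendsto_real_sqrt)
    then have "(\<lambda>j. cmod (\<Sum>n=1..(Suc j)\<^sup>2. z n x) / real ((Suc j)\<^sup>2)) \<longlonglongrightarrow> 0"
      by (simp add: f_def)
    then have "(\<lambda>j. cmod (\<Sum>n=1..j\<^sup>2. z n x) / real (j\<^sup>2)) \<longlonglongrightarrow> 0"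
      by (rule LIMSEQ_imp_Suc)
    then show "(\<lambda>N. (\<Sum>n=1..N. z n x) / of_nat N) \<longlonglongrightarrow> 0"
      by (rule averages_tendsto_0_of_squares[OF bound])
  qed
qed

text \<open>Adding one term increases the mean square by its own square, which integrates to the
  total mass, and by twice the real parts of its correlations with earlier terms, which a geometric
  series bounds. The increment is thus bounded independently of \<open>N\<close>.\<close>

lemma (in finite_measure) L2_sum_le:
  fixes \<theta> :: "nat \<Rightarrow> 'a \<Rightarrow> real"
  assumes [measurable]: "\<And>n. \<theta> n \<in> borel_measurable M"
    and \<rho>: "0 \<le> \<rho>" "\<rho> < 1"
    and corr: "\<And>m n. cmod (\<integral>x. cis (\<theta> (m + n) x - \<theta> m x) \<partial>M) \<le> \<rho> ^ n"
  shows "(\<integral>x. (cmod (\<Sum>n=1..N. cis (\<theta> n x)))\<^sup>2 \<partial>M) \<le> (measure M (space M) + 2 / (1 - \<rho>)) * real N"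
proof (induction N)
  case (Suc N)
  have cis_meas: "(\<lambda>x. cis (g x)) \<in> borel_measurable M" if "g \<in> borel_measurable M" for g
    by (rule measurable_compose[OF that]) (intro borel_measurable_continuous_onI continuous_intros)
  have [measurable]: "(\<lambda>x. cis (\<theta> n x)) \<in> borel_measurable M" for n by (rule cis_meas) measurable
  define S where "S x = (\<Sum>n=1..N. cis (\<theta> n x))" for x
  have S_le: "cmod (S x) \<le> real N" for x
    using sum_norm_le[of "{1..N}" "\<lambda>n. cis (\<theta> n x)" "\<lambda>_. 1"] by (simp add: S_def)
  have [measurable]: "S \<in> borel_measurable M" unfolding S_def by measurable
  have i1: "integrable M (\<lambda>x. (cmod (S x))\<^sup>2)"
  proof (rule integrable_const_bound[where B = "(real N)\<^sup>2"])
    show "AE x in M. norm ((cmod (S x))\<^sup>2) \<le> (real N)\<^sup>2" using S_le by (auto intro!: power_mono)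
  qed measurable
  have i2: "integrable M (\<lambda>x. cis (\<theta> (Suc N) x - \<theta> m x))" for m
    by (rule integrable_const_bound[where B = 1]) (auto intro!: cis_meas)
  have eq: "(cmod (\<Sum>n=1..Suc N. cis (\<theta> n x)))\<^sup>2
      = (cmod (S x))\<^sup>2 + (1 + 2 * Re (\<Sum>m=1..N. cis (\<theta> (Suc N) x - \<theta> m x)))" for x
  proof -
    have "(\<Sum>m=1..N. cis (\<theta> (Suc N) x - \<theta> m x)) = cis (\<theta> (Suc N) x) * cnj (S x)"
      by (simp add: S_def sum_distrib_left cis_cnj cis_mult)
    moreover have "(cmod (a + b))\<^sup>2 = (cmod a)\<^sup>2 + (cmod b)\<^sup>2 + 2 * Re (b * cnj a)" for a b
      unfolding cmod_power2 by (simp add: power2_eq_square algebra_simps)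
    moreover have "(\<Sum>n=1..Suc N. cis (\<theta> n x)) = S x + cis (\<theta> (Suc N) x)" by (simp add: S_def)
    ultimately show ?thesis by (simp only: norm_cis power_one add.assoc)
  qed
  have corr': "cmod (\<integral>x. cis (\<theta> (Suc N) x - \<theta> m x) \<partial>M) \<le> \<rho> ^ (Suc N - m)" if "m \<in> {1..N}" for m
    using corr[of m "Suc N - m"] that by simp
  have geo: "(\<Sum>m=1..N. \<rho> ^ (Suc N - m)) \<le> 1 / (1 - \<rho>)"
  proof -
    have "(\<Sum>m=1..N. \<rho> ^ (Suc N - m)) = (\<Sum>i\<in>{1..N}. \<rho> ^ i)"
      by (rule sum.reindex_bij_witness[of _ "\<lambda>i. Suc N - i" "\<lambda>i. Suc N - i"]) auto
    also have "\<dots> \<le> (\<Sum>i. \<rho> ^ i)"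
      using \<rho> by (intro sum_le_suminf summable_geometric) auto
    finally show ?thesis using \<rho> by (simp add: suminf_geometric)
  qed
  have "(\<integral>x. (cmod (\<Sum>n=1..Suc N. cis (\<theta> n x)))\<^sup>2 \<partial>M)
      = (\<integral>x. (cmod (S x))\<^sup>2 \<partial>M) + (measure M (space M) + 2 * Re (\<Sum>m=1..N. \<integral>x. cis (\<theta> (Suc N) x - \<theta> m x) \<partial>M))"
  proof -
    define R where "R x = (\<Sum>m=1..N. cis (\<theta> (Suc N) x - \<theta> m x))" for x
    have R: "integrable M R" unfolding R_def using i2 by (intro Bochner_Integration.integrable_sum)
    have "(\<integral>x. R x \<partial>M) = (\<Sum>m=1..N. \<integral>x. cis (\<theta> (Suc N) x - \<theta> m x) \<partial>M)"
      unfolding R_def using i2 by (rule Bochner_Integration.integral_sum)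
    moreover have "(\<integral>x. (cmod (S x))\<^sup>2 + (1 + 2 * Re (R x)) \<partial>M)
        = (\<integral>x. (cmod (S x))\<^sup>2 \<partial>M) + (measure M (space M) + 2 * Re (\<integral>x. R x \<partial>M))"
      using i1 R by simp
    ultimately show ?thesis unfolding eq R_def by simp
  qed
  also have "\<dots> \<le> (measure M (space M) + 2 / (1 - \<rho>)) * real N + (measure M (space M) + 2 * (1 / (1 - \<rho>)))"
  proof (intro add_mono mult_left_mono)
    have "Re (\<Sum>m=1..N. \<integral>x. cis (\<theta> (Suc N) x - \<theta> m x) \<partial>M) \<le> cmod (\<Sum>m=1..N. \<integral>x. cis (\<theta> (Suc N) x - \<theta> m x) \<partial>M)"
      by (rule complex_Re_le_cmod)
    also have "\<dots> \<le> (\<Sum>m=1..N. \<rho> ^ (Suc N - m))" by (rule sum_norm_le) (rule corr')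
    finally show "Re (\<Sum>m=1..N. \<integral>x. cis (\<theta> (Suc N) x - \<theta> m x) \<partial>M) \<le> 1 / (1 - \<rho>)" using geo by simp
  qed (use Suc.IH in \<open>auto simp: S_def\<close>)
  also have "\<dots> = (measure M (space M) + 2 / (1 - \<rho>)) * real (Suc N)"
    by (simp add: algebra_simps add_divide_distrib)
  finally show ?case .
qed simp

section \<open>Weyl's criterion\<close>

text \<open>The inductive form avoids families of coefficients: closure under products and
  equidistribution follow by rule induction.\<close>

inductive trig_poly :: "(real \<Rightarrow> complex) \<Rightarrow> bool" where
  trig_poly_term: "trig_poly (\<lambda>u. c * cis (2 * pi * of_int k * u))"
| trig_poly_add: "trig_poly f \<Longrightarrow> trig_poly g \<Longrightarrow> trig_poly (\<lambda>u. f u + g u)"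

lemma trig_poly_mult:
  assumes "trig_poly f" "trig_poly g"
  shows "trig_poly (\<lambda>u. f u * g u)"
  using assms
proof (induction f)
  case (trig_poly_term c k)
  from trig_poly_term.prems show ?case
  proof (induction g)
    case (trig_poly_term d l)
    have "(\<lambda>u. c * cis (2 * pi * of_int k * u) * (d * cis (2 * pi * of_int l * u)))
        = (\<lambda>u. (c * d) * cis (2 * pi * of_int (k + l) * u))"
      by (simp add: fun_eq_iff cis_mult[symmetric] distrib_left distrib_right)
    then show ?case by (simp only: trig_poly.trig_poly_term)
  next
    case (trig_poly_add f g)
    then show ?case by (simp only: distrib_left trig_poly.trig_poly_add)
  qed
next
  case (trig_poly_add f1 f2)
  then show ?case by (simp only: distrib_right trig_poly.trig_poly_add)
qed

lemma trig_poly_const: "trig_poly (\<lambda>u. c)"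
  using trig_poly_term[of c 0] by simp

text \<open>The link to Stone-Weierstrass on the unit circle: a real linear functional there
  combines the frequencies 1 and -1, and sums and products stay trigonometric.\<close>

lemma trig_poly_real_polynomial:
  fixes p :: "complex \<Rightarrow> real"
  assumes "real_polynomial_function p"
  shows "trig_poly (\<lambda>u. of_real (p (cis (2 * pi * u))))"
  using assms
proof (induction p)
  case (linear p)
  then interpret bounded_linear p .
  \<comment> \<open>Chosen so that \<open>p z\<close> is twice the real part of
    \<open>c * z\<close>, that is, \<open>c * z\<close> plus its conjugate.\<close>
  define c where "c = Complex (p 1 / 2) (- p \<i> / 2)"
  have p: "p z = Re z * p 1 + Im z * p \<i>" for z
  proof -
    have "z = Re z *\<^sub>R 1 + Im z *\<^sub>R \<i>" by (simp add: complex_eq_iff)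
    then have "p z = p (Re z *\<^sub>R 1 + Im z *\<^sub>R \<i>)" by (rule arg_cong)
    then show ?thesis by (simp only: add scaleR real_scaleR_def)
  qed
  have "(\<lambda>u. complex_of_real (p (cis (2 * pi * u))))
      = (\<lambda>u. c * cis (2 * pi * of_int 1 * u) + cnj c * cis (2 * pi * of_int (- 1) * u))"
    by (simp add: fun_eq_iff complex_eq_iff p[of "cis _"] c_def algebra_simps)
  then show ?case by (simp only: trig_poly.intros)
next
  case (const c)
  show ?case by (rule trig_poly_const)
next
  case (add f g)
  then show ?case by (simp add: trig_poly.trig_poly_add)
next
  case (mult f g)
  then show ?case by (simp add: trig_poly_mult)
qed

lemma has_integral_cis_period:
  "((\<lambda>u. c * cis (2 * pi * of_int k * u)) has_integral (if k = 0 then c else 0)) {0..1::real}"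
proof (cases "k = 0")
  case True
  then show ?thesis using has_integral_const_real[of c 0 1] by simp
next
  case False
  define w where "w = 2 * pi * of_int k"
  have w: "w \<noteq> 0" using False by (simp add: w_def)
  have "((\<lambda>u. c * cis (w * u)) has_integral (c / (\<i> * of_real w) * cis (w * 1) - c / (\<i> * of_real w) * cis (w * 0))) {0..1}"
    by (rule fundamental_theorem_of_calculus)
      (use w in \<open>auto intro!: derivative_eq_intros simp: has_vector_derivative_def fun_eq_iff scaleR_conv_of_real field_simps\<close>)
  moreover have "cis (w * 1) = 1"
    using cis_multiple_2pi[of "of_int k"] by (simp add: w_def)
  ultimately show ?thesis using False by (simp add: w_def)
qed

text \<open>The integral and the limit are bound by one existential value, so both travel through
  the induction together.\<close>

lemma trig_poly_equidistributed:
  fixes x :: "nat \<Rightarrow> real"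
  assumes weyl: "\<And>h::nat. h \<ge> 1 \<Longrightarrow> (\<lambda>N. (\<Sum>n=1..N. cis (2 * pi * real h * x n)) / of_nat N) \<longlonglongrightarrow> 0"
    and "trig_poly f"
  shows "\<exists>v. (f has_integral v) {0..1} \<and> (\<lambda>N. (\<Sum>n=1..N. f (x n)) / of_nat N) \<longlonglongrightarrow> v"
  using assms(2)
proof (induction f)
  case (trig_poly_term c k)
  have "(\<lambda>N. (\<Sum>n=1..N. cis (2 * pi * of_int k * x n)) / of_nat N) \<longlonglongrightarrow> (if k = 0 then 1 else 0)"
  proof -
    consider "k = 0" | "k > 0" | "k < 0" by linarith
    then show ?thesis
    proof cases
      case 1
      have "\<forall>\<^sub>F N in sequentially. (\<Sum>n=1..N. cis (2 * pi * of_int k * x n)) / of_nat N = 1"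
        using eventually_gt_at_top[of 0] by eventually_elim (simp add: 1)
      then show ?thesis using 1 by (simp add: tendsto_eventually)
    next
      case 2
      then show ?thesis using weyl[of "nat k"] by simp
    next
      case 3
      \<comment> \<open>The hypothesis covers positive frequencies; negative ones follow by
        conjugation.\<close>
      have "(\<lambda>N. cnj ((\<Sum>n=1..N. cis (2 * pi * nat (- k) * x n)) / of_nat N)) \<longlonglongrightarrow> cnj 0"
        using 3 by (intro tendsto_cnj weyl) auto
      then show ?thesis using 3 by (simp add: cis_cnj)
    qed
  qed
  from tendsto_mult_left[OF this, of c]
  have "(\<lambda>N. (\<Sum>n=1..N. c * cis (2 * pi * of_int k * x n)) / of_nat N) \<longlonglongrightarrow> (if k = 0 then c else 0)"
    by (simp add: sum_distrib_left if_distrib cong: if_cong)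
  with has_integral_cis_period[of c k] show ?case by blast
next
  case (trig_poly_add f g)
  then obtain v w where "(f has_integral v) {0..1}" "(\<lambda>N. (\<Sum>n=1..N. f (x n)) / of_nat N) \<longlonglongrightarrow> v"
    "(g has_integral w) {0..1}" "(\<lambda>N. (\<Sum>n=1..N. g (x n)) / of_nat N) \<longlonglongrightarrow> w" by blast
  then have "((\<lambda>u. f u + g u) has_integral v + w) {0..1}"
    "(\<lambda>N. (\<Sum>n=1..N. f (x n) + g (x n)) / of_nat N) \<longlonglongrightarrow> v + w"
    by (auto intro: has_integral_add tendsto_add simp: sum.distrib add_divide_distrib)
  then show ?case by blast
qed

text \<open>Periodic functions are written as \<open>F\<close> on the circle, where a polynomial
  approximates uniformly. The three errors, in the integral, in the averages and in the limit for
  the polynomial, are each controlled by \<open>e\<close>, a third of \<epsilon>.\<close>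

lemma continuous_equidistributed:
  fixes x :: "nat \<Rightarrow> real" and F :: "complex \<Rightarrow> real"
  assumes weyl: "\<And>h::nat. h \<ge> 1 \<Longrightarrow> (\<lambda>N. (\<Sum>n=1..N. cis (2 * pi * real h * x n)) / of_nat N) \<longlonglongrightarrow> 0"
    and F: "continuous_on UNIV F"
  shows "(\<lambda>N. (\<Sum>n=1..N. F (cis (2 * pi * x n))) / N) \<longlonglongrightarrow> integral {0..1} (\<lambda>u. F (cis (2 * pi * u)))"
proof (rule LIMSEQ_I)
  fix \<epsilon> :: real assume "\<epsilon> > 0"
  define e where "e = \<epsilon> / 3"
  have e: "e > 0" using \<open>\<epsilon> > 0\<close> by (simp add: e_def)
  obtain p where p: "real_polynomial_function p" "\<And>z. z \<in> sphere 0 1 \<Longrightarrow> \<bar>F z - p z\<bar> < e"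
    using Stone_Weierstrass_real_polynomial_function[of "sphere 0 1" F e] F e
    by (metis compact_sphere continuous_on_subset subset_UNIV)
  have Fp: "\<bar>F (cis u) - p (cis u)\<bar> \<le> e" for u using p(2)[of "cis u"] by simp
  let ?f = "\<lambda>u. F (cis (2 * pi * u))"
  let ?g = "\<lambda>u. p (cis (2 * pi * u))"
  obtain v where v: "((\<lambda>u. complex_of_real (?g u)) has_integral v) {0..1}"
    "(\<lambda>N. (\<Sum>n=1..N. complex_of_real (?g (x n))) / of_nat N) \<longlonglongrightarrow> v"
    using trig_poly_equidistributed[OF weyl trig_poly_real_polynomial[OF p(1)]] by blast
  have g_int: "(?g has_integral Re v) {0..1}" using has_integral_Re[OF v(1)] by simp
  have g_lim: "(\<lambda>N. (\<Sum>n=1..N. ?g (x n)) / N) \<longlonglongrightarrow> Re v"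
    using tendsto_Re[OF v(2)] by (simp flip: of_real_sum)
  have f_int: "?f integrable_on {0..1}"
    by (intro integrable_continuous_real continuous_intros continuous_on_compose2[OF F]) auto
  have i: "\<bar>integral {0..1} ?f - Re v\<bar> \<le> e"
  proof -
    have "norm (integral {0..1} (\<lambda>u. ?f u - ?g u)) \<le> integral {0..1::real} (\<lambda>_. e)"
      using f_int has_integral_integrable[OF g_int] Fp
      by (intro Henstock_Kurzweil_Integration.integral_norm_bound_integral
            Henstock_Kurzweil_Integration.integrable_diff) auto
    then show ?thesis
      using Henstock_Kurzweil_Integration.integral_diff[OF f_int has_integral_integrable[OF g_int]] integral_unique[OF g_int] by simp
  qed
  from g_lim e obtain N0 where N0: "\<And>N. N \<ge> N0 \<Longrightarrow> \<bar>(\<Sum>n=1..N. ?g (x n)) / N - Re v\<bar> < e"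
    unfolding LIMSEQ_iff by (metis real_norm_def)
  have d: "\<bar>(\<Sum>n=1..N. ?f (x n)) / N - (\<Sum>n=1..N. ?g (x n)) / N\<bar> \<le> e" for N :: nat
  proof (cases "N = 0")
    case False
    have "\<bar>\<Sum>n=1..N. ?f (x n) - ?g (x n)\<bar> \<le> (\<Sum>n=1..N. e)"
      using Fp by (intro order.trans[OF sum_abs] sum_mono)
    then show ?thesis using False
      by (simp add: sum_subtractf flip: diff_divide_distrib) (simp add: field_simps)
  qed (use e in simp)
  have "\<bar>(\<Sum>n=1..N. ?f (x n)) / N - integral {0..1} ?f\<bar> < \<epsilon>" if "N \<ge> N0" for N
    using i d[of N] N0[OF that] e_def by linarith
  then show "\<exists>no. \<forall>n\<ge>no. norm ((\<Sum>k=1..n. ?f (x k)) / n - integral {0..1} ?f) < \<epsilon>"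
    by auto
qed

text \<open>The arc is a superlevel set of a cosine centred at its midpoint. Outside it
  \<open>d\<close> lies between \<open>b - a\<close> and \<open>2 - (b - a)\<close>, and
  \<open>cos (pi * d)\<close> is symmetric about \<open>d = 1\<close> and decreasing before
  that.\<close>

lemma cos_outside_arc_le:
  assumes ab: "0 \<le> a" "a < b" "b \<le> 1" and u: "0 \<le> u" "u \<le> 1" "\<not> (a < u \<and> u < b)"
  shows "cos (2 * pi * u - pi * (a + b)) \<le> cos (pi * (b - a))"
proof -
  define d where "d = \<bar>2 * u - (a + b)\<bar>"
  have d: "b - a \<le> d" "d \<le> 2 - (b - a)" using ab u by (auto simp: d_def)
  have "2 * pi * u - pi * (a + b) = pi * (2 * u - (a + b))" by (simp add: algebra_simps)
  moreover have "\<bar>pi * (2 * u - (a + b))\<bar> = pi * d" by (simp add: d_def abs_mult)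
  ultimately have "cos (2 * pi * u - pi * (a + b)) = cos (pi * d)" by (metis cos_abs_real)
  also have "\<dots> \<le> cos (pi * (b - a))"
  proof (cases "d \<le> 1")
    case True
    then show ?thesis using d ab by (intro cos_monotone_0_pi_le) auto
  next
    case False
    have "cos (pi * d) = cos (2 * pi - pi * d)" by (simp add: cos_diff)
    also have "2 * pi - pi * d = pi * (2 - d)" by (simp add: algebra_simps)
    also have "cos (pi * (2 - d)) \<le> cos (pi * (b - a))"
      using d ab False by (intro cos_monotone_0_pi_le) auto
    finally show ?thesis .
  qed
  finally show ?thesis .
qed

lemma cis_2pi_frac: "cis (2 * pi * frac u) = cis (2 * pi * u)"
proof -
  have "2 * pi * u = 2 * pi * frac u + 2 * pi * of_int \<lfloor>u\<rfloor>"
    by (simp add: frac_def algebra_simps)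
  then show ?thesis by (metis Ints_of_int cis_mult cis_multiple_2pi mult.right_neutral)
qed

text \<open>A continuous bump supported on the arc, equal to 1 on a slightly shorter arc, bounds the
  frequency of visits from below. Applied to two complementary arcs this is enough.\<close>

lemma arc_frequency_ge:
  fixes x :: "nat \<Rightarrow> real"
  assumes weyl: "\<And>h::nat. h \<ge> 1 \<Longrightarrow> (\<lambda>N. (\<Sum>n=1..N. cis (2 * pi * real h * x n)) / of_nat N) \<longlonglongrightarrow> 0"
    and ab: "0 \<le> a" "a < b" "b \<le> 1" and "\<epsilon> > 0"
  shows "\<forall>\<^sub>F N in sequentially. b - a - \<epsilon> < real (card {n \<in> {1..N}. a < frac (x n) \<and> frac (x n) < b}) / real N"
proof -
  define e where "e = min (\<epsilon> / 2) ((b - a) / 2)"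
  have e: "0 < e" "e < \<epsilon>" "e < b - a" using assms by (auto simp: e_def min_def)
  define c0 where "c0 = cos (pi * (b - a))"
  define c1 where "c1 = cos (pi * (b - a - e))"
  have c01: "c0 < c1" unfolding c0_def c1_def using e ab by (intro cos_monotone_0_pi) auto
  \<comment> \<open>The cosine of \<open>cos_outside_arc_le\<close>, rescaled and clipped:
    \<open>c0\<close> is its value at the ends of the arc, \<open>c1\<close> its value after
    shortening the arc by \<open>e / 2\<close> at each end.\<close>
  define F where "F z = max 0 (min 1 ((Re (z * cis (- (pi * (a + b)))) - c0) / (c1 - c0)))" for z
  have F: "continuous_on UNIV F" unfolding F_def using c01 by (intro continuous_intros) auto
  have Fcis: "F (cis (2 * pi * u)) = max 0 (min 1 ((cos (2 * pi * u - pi * (a + b)) - c0) / (c1 - c0)))" for u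
    unfolding F_def cis_mult by simp
  have F_le: "F (cis (2 * pi * u)) \<le> of_bool (a < frac u \<and> frac u < b)" for u
  proof (cases "a < frac u \<and> frac u < b")
    case False
    then have "cos (2 * pi * frac u - pi * (a + b)) \<le> c0"
      unfolding c0_def by (intro cos_outside_arc_le[OF ab]) (auto simp: frac_lt_1 less_imp_le)
    then have "(cos (2 * pi * frac u - pi * (a + b)) - c0) / (c1 - c0) \<le> 0"
      using c01 by (intro divide_nonpos_pos) auto
    then have "F (cis (2 * pi * frac u)) = 0" unfolding Fcis by simp
    then show ?thesis by (simp add: cis_2pi_frac)
  qed (simp add: F_def)
  have int: "(\<lambda>u. F (cis (2 * pi * u))) integrable_on {0..1}"
    by (intro integrable_continuous_real continuous_intros continuous_on_compose2[OF F]) auto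
  have "b - a - e \<le> integral {0..1} (\<lambda>u. F (cis (2 * pi * u)))"
  proof -
    have one: "F (cis (2 * pi * u)) = 1" if "u \<in> {a + e / 2..b - e / 2}" for u
    proof -
      have "\<bar>2 * u - (a + b)\<bar> \<le> b - a - e" using that by (auto simp: abs_le_iff)
      then have "pi * \<bar>2 * u - (a + b)\<bar> \<le> pi * (b - a - e)" by simp
      then have "c1 \<le> cos (pi * \<bar>2 * u - (a + b)\<bar>)"
        unfolding c1_def using e ab by (intro cos_monotone_0_pi_le) auto
      also have "pi * \<bar>2 * u - (a + b)\<bar> = \<bar>2 * pi * u - pi * (a + b)\<bar>"
        by (simp add: abs_mult[symmetric, of pi, simplified] algebra_simps)
      finally have "c1 \<le> cos (2 * pi * u - pi * (a + b))" by simp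
      then have "1 \<le> (cos (2 * pi * u - pi * (a + b)) - c0) / (c1 - c0)" using c01 by simp
      then show ?thesis by (simp add: Fcis)
    qed
    have sub: "{a + e / 2..b - e / 2} \<subseteq> {0..1}" using ab e by auto
    have "b - a - e = integral {a + e / 2..b - e / 2} (\<lambda>u. 1)" using e by simp
    also have "\<dots> = integral {a + e / 2..b - e / 2} (\<lambda>u. F (cis (2 * pi * u)))"
      by (rule integral_cong) (simp add: one)
    also have "\<dots> \<le> integral {0..1} (\<lambda>u. F (cis (2 * pi * u)))"
      by (rule integral_subset_le[OF sub integrable_on_subinterval[OF int sub] int]) (simp add: F_def)
    finally show ?thesis .
  qed
  then have "b - a - \<epsilon> < integral {0..1} (\<lambda>u. F (cis (2 * pi * u)))" using e by simp
  moreover have "(\<lambda>N. (\<Sum>n=1..N. F (cis (2 * pi * x n))) / N) \<longlonglongrightarrow> integral {0..1} (\<lambda>u. F (cis (2 * pi * u)))"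
    by (rule continuous_equidistributed[OF weyl F])
  ultimately have "\<forall>\<^sub>F N in sequentially. b - a - \<epsilon> < (\<Sum>n=1..N. F (cis (2 * pi * x n))) / N"
    by (intro order_tendstoD(1))
  then
  show ?thesis
  proof eventually_elim
    case (elim N)
    have "(\<Sum>n=1..N. F (cis (2 * pi * x n))) \<le> (\<Sum>n=1..N. of_bool (a < frac (x n) \<and> frac (x n) < b))"
      by (intro sum_mono F_le)
    also have "\<dots> = real (card {n \<in> {1..N}. a < frac (x n) \<and> frac (x n) < b})"
      by (simp add: of_bool_def sum.If_cases Int_def)
    finally have "(\<Sum>n=1..N. F (cis (2 * pi * x n))) / N \<le> real (card {n \<in> {1..N}. a < frac (x n) \<and> frac (x n) < b}) / N"
      by (rule divide_right_mono) simp
    with elim show ?case by linarith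
  qed
qed

text \<open>The open arc from 0 to \<open>t\<close> bounds the frequency from below by inclusion.
  The open arc from \<open>t\<close> to 1 collects exactly the indices that are not counted, which
  gives the upper bound.\<close>

theorem weyl_criterion:
  fixes x :: "nat \<Rightarrow> real"
  assumes weyl: "\<And>h::nat. h \<ge> 1 \<Longrightarrow> (\<lambda>N. (\<Sum>n=1..N. cis (2 * pi * real h * x n)) / of_nat N) \<longlonglongrightarrow> 0"
    and t: "0 \<le> t" "t < 1"
  shows "(\<lambda>N. real (card {n \<in> {1..N}. frac (x n) \<le> t}) / real N) \<longlonglongrightarrow> t"
proof (rule order_tendstoI)
  fix l assume l: "l < t"
  show "\<forall>\<^sub>F N in sequentially. l < real (card {n \<in> {1..N}. frac (x n) \<le> t}) / real N"
  proof (cases "t = 0")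
    \<comment> \<open>For \<open>t = 0\<close> there is no arc, but \<open>l\<close> is negative and
      frequencies are not.\<close>
    case True
    then show ?thesis using l by (intro always_eventually allI) (auto intro: less_le_trans)
  next
    case False
    with t l have "\<forall>\<^sub>F N in sequentially. t - 0 - (t - l) < real (card {n \<in> {1..N}. 0 < frac (x n) \<and> frac (x n) < t}) / real N"
      by (intro arc_frequency_ge[OF weyl]) auto
    then show ?thesis
    proof eventually_elim
      case (elim N)
      have "card {n \<in> {1..N}. 0 < frac (x n) \<and> frac (x n) < t} \<le> card {n \<in> {1..N}. frac (x n) \<le> t}"
        by (intro card_mono) auto
      then have "real (card {n \<in> {1..N}. 0 < frac (x n) \<and> frac (x n) < t}) / N \<le> card {n \<in> {1..N}. frac (x n) \<le> t} / N"
        by (intro divide_right_mono) auto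
      with elim show ?case by linarith
    qed
  qed
next
  fix l assume l: "t < l"
  with t have "\<forall>\<^sub>F N in sequentially. 1 - t - (l - t) < real (card {n \<in> {1..N}. t < frac (x n) \<and> frac (x n) < 1}) / real N"
    by (intro arc_frequency_ge[OF weyl]) auto
  then show "\<forall>\<^sub>F N in sequentially. real (card {n \<in> {1..N}. frac (x n) \<le> t}) / real N < l"
    using eventually_gt_at_top[of 0]
  proof eventually_elim
    case (elim N)
    have "{1..N} = {n \<in> {1..N}. frac (x n) \<le> t} \<union> {n \<in> {1..N}. t < frac (x n) \<and> frac (x n) < 1}"
      by (auto simp: frac_lt_1)
    then have "card {1..N} = card {n \<in> {1..N}. frac (x n) \<le> t} + card {n \<in> {1..N}. t < frac (x n) \<and> frac (x n) < 1}"
      by (metis (no_types, lifting) card_Un_disjoint disjoint_iff finite_Un finite_atLeastAtMost linorder_not_le mem_Collect_eq)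
    then have "real N = real (card {n \<in> {1..N}. frac (x n) \<le> t}) + real (card {n \<in> {1..N}. t < frac (x n) \<and> frac (x n) < 1})"
      by simp
    then have "1 = real (card {n \<in> {1..N}. frac (x n) \<le> t}) / N + real (card {n \<in> {1..N}. t < frac (x n) \<and> frac (x n) < 1}) / N"
      using elim(2) by (simp flip: add_divide_distrib)
    with elim(1) show ?case by linarith
  qed
qed

section \<open>Denominators of convergents\<close>

text \<open>Numerator and denominator without reduction, using that 1 / (a + p/q) = q / (a q +
  p).\<close>

fun cf_fraction :: "nat list \<Rightarrow> int \<times> int" where
  "cf_fraction [] = (0, 1)"
| "cf_fraction (a # as) = (snd (cf_fraction as), int a * snd (cf_fraction as) + fst (cf_fraction as))"

text \<open>Coprimality persists because gcd(q, a q + p) = gcd(q, p). Hence the pair is already the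
  reduced fraction that \<open>quotient_of\<close> returns.\<close>

lemma cf_fraction_props:
  assumes "\<forall>a\<in>set as. a > 0"
  shows "fst (cf_fraction as) \<ge> 0 \<and> snd (cf_fraction as) > 0 \<and>
    coprime (fst (cf_fraction as)) (snd (cf_fraction as)) \<and>
    cf_value as = Fract (fst (cf_fraction as)) (snd (cf_fraction as))"
  using assms
proof (induction as)
  case (Cons a as)
  define p where "p = fst (cf_fraction as)"
  define q where "q = snd (cf_fraction as)"
  have IH: "p \<ge> 0" "q > 0" "coprime p q" "cf_value as = Fract p q" and a: "a > 0"
    using Cons by (auto simp: p_def q_def)
  have pos: "int a * q + p > 0" using IH a by (simp add: add_pos_nonneg)
  have "coprime q (int a * q + p)" using IH(3)
    by (metis coprime_commute coprime_iff_gcd_eq_1 gcd_add_mult add.commute)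
  moreover have "cf_value (a # as) = Fract q (int a * q + p)"
  proof -
    have "of_nat a + of_int p / (of_int q :: rat) = of_int (int a * q + p) / of_int q"
      using IH(2) by (simp add: field_simps)
    then show ?thesis using IH(2) by (simp add: IH(4) Fract_of_int_quotient)
  qed
  ultimately show ?case using IH pos by (simp add: p_def q_def)
qed (simp add: rat_number_collapse)

lemma cf_digits_Suc:
  "map (\<lambda>i. cf_digit i x) [1..<Suc n + 1] =
     nat \<lfloor>1 / x\<rfloor> # map (\<lambda>i. cf_digit i (gauss_map x)) [1..<n + 1]"
proof -
  have "[1..<Suc n + 1] = 1 # map Suc [1..<n + 1]"
    by (simp add: upt_conv_Cons map_Suc_upt del: upt_Suc)
  moreover have "cf_digit (Suc i) x = cf_digit i (gauss_map x)" if "i \<ge> 1" for i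
    using that by (cases i) (simp_all add: cf_digit_def funpow_swap1)
  then have "map (\<lambda>i. cf_digit i x) (map Suc [1..<n + 1]) = map (\<lambda>i. cf_digit i (gauss_map x)) [1..<n + 1]"
    by (simp del: upt_Suc)
  ultimately show ?thesis by (simp only: list.map) (simp add: cf_digit_def)
qed

text \<open>Irrationality is the invariant that keeps the orbit away from 0 and all digits
  positive.\<close>

lemma gauss_map_irrational:
  assumes "x \<in> {0<..<1}" "x \<notin> \<rat>"
  shows "gauss_map x \<in> {0<..<1}" "gauss_map x \<notin> \<rat>" "\<lfloor>1 / x\<rfloor> \<ge> 1"
proof -
  show *: "gauss_map x \<notin> \<rat>"
  proof
    assume "gauss_map x \<in> \<rat>"
    then have "gauss_map x + of_int \<lfloor>1 / x\<rfloor> \<in> \<rat>" by (intro Rats_add Rats_of_int)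
    then have "1 / x \<in> \<rat>" by (simp add: gauss_map_def)
    then have "1 / (1 / x) \<in> \<rat>" by (rule Rats_divide[OF Rats_1])
    with assms show False by simp
  qed
  then have "gauss_map x \<noteq> 0" by (metis Rats_0)
  moreover have "gauss_map x = frac (1 / x)" by (simp add: gauss_map_def frac_def)
  ultimately show "gauss_map x \<in> {0<..<1}" using frac_ge_0[of "1 / x"] frac_lt_1[of "1 / x"] by auto
  show "\<lfloor>1 / x\<rfloor> \<ge> 1" using assms by simp
qed

lemma cf_digits_pos:
  assumes "x \<in> {0<..<1}" "x \<notin> \<rat>"
  shows "\<forall>a\<in>set (map (\<lambda>i. cf_digit i x) [1..<n + 1]). a > 0"
  using assms
proof (induction n arbitrary: x)
  case (Suc n)
  have "nat \<lfloor>1 / x\<rfloor> > 0" using gauss_map_irrational(3)[OF Suc.prems] by linarith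
  then show ?case
    using Suc.IH[OF gauss_map_irrational(1,2)[OF Suc.prems]] unfolding cf_digits_Suc by simp
qed simp

text \<open>The induction needs all \<open>r\<close>, since the ratio changes at each step. It
  closes by (a + r) (q + p / (a + r)) = (a q + p) + r q, where \<open>q\<close> is the new
  numerator.\<close>

lemma exp_log_denom:
  assumes "x \<in> {0<..<1}" "x \<notin> \<rat>" "r \<ge> 0"
  defines "as \<equiv> \<lambda>n x. map (\<lambda>i. cf_digit i x) [1..<n + 1]"
  shows "exp (log_denom n r x) = of_int (snd (cf_fraction (as n x))) + r * of_int (fst (cf_fraction (as n x)))"
  using assms(1-3)
proof (induction n arbitrary: x r)
  case 0
  then show ?case by (simp add: as_def)
next
  case (Suc n)
  note x' = gauss_map_irrational[OF Suc.prems(1,2)]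
  define a where "a = real_of_int \<lfloor>1 / x\<rfloor>"
  have "a \<ge> 1" using x'(3) unfolding a_def by linarith
  then have pos: "a + r > 0" using Suc.prems by simp
  define p where "p = real_of_int (fst (cf_fraction (as n (gauss_map x))))"
  define q where "q = real_of_int (snd (cf_fraction (as n (gauss_map x))))"
  have "exp (log_denom (Suc n) r x) = (a + r) * exp (log_denom n (1 / (a + r)) (gauss_map x))"
    using pos by (simp add: exp_add a_def)
  also have "exp (log_denom n (1 / (a + r)) (gauss_map x)) = q + 1 / (a + r) * p"
    unfolding p_def q_def using pos by (intro Suc.IH x') simp
  also have "(a + r) * (q + 1 / (a + r) * p) = (a * q + p) + r * q" using pos by (simp add: field_simps)
  also have "\<dots> = of_int (snd (cf_fraction (as (Suc n) x))) + r * of_int (fst (cf_fraction (as (Suc n) x)))"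
    using Suc.prems(1) by (simp only: as_def cf_digits_Suc cf_fraction.simps fst_conv snd_conv)
      (simp add: p_def q_def as_def a_def del: upt_Suc)
  finally show ?case .
qed

lemma cf_denom_eq:
  assumes "x \<in> {0<..<1}" "x \<notin> \<rat>"
  shows "real_of_int (cf_denom n x) = exp (log_denom n 0 x)"
proof -
  obtain p q where "cf_fraction (map (\<lambda>i. cf_digit i x) [1..<n + 1]) = (p, q)" by fastforce
  then show ?thesis
    using exp_log_denom[OF assms, of 0 n] cf_fraction_props[OF cf_digits_pos[OF assms, of n]]
    by (simp add: cf_denom_def quotient_of_Fract del: upt_Suc)
qed

section \<open>Significands and decimal logarithms\<close>

lemma significand_powr: "significand (10 powr y) = 10 powr frac y"
  unfolding significand_def
proof (rule the_equality)
  have "10 powr y = 10 powr of_int \<lfloor>y\<rfloor> * 10 powr frac y"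
    by (simp add: frac_def flip: powr_add)
  moreover have "10 powr frac y < 10 powr 1" using frac_lt_1[of y] by (intro powr_less_mono) auto
  moreover have "10 powr frac y \<ge> 10 powr 0" by (intro powr_mono) auto
  ultimately show "1 \<le> 10 powr frac y \<and> 10 powr frac y < 10 \<and> (\<exists>k::int. \<bar>10 powr y\<bar> = 10 powr of_int k * 10 powr frac y)"
    by auto
next
  fix t :: real assume "1 \<le> t \<and> t < 10 \<and> (\<exists>k::int. \<bar>10 powr y\<bar> = 10 powr of_int k * t)"
  then obtain k :: int where t: "1 \<le> t" "t < 10" and k: "10 powr y = 10 powr of_int k * t" by auto
  have tl: "t = 10 powr log 10 t" using t by simp
  have "10 powr y = 10 powr (of_int k + log 10 t)" using k tl by (simp add: powr_add)
  then have y: "y = of_int k + log 10 t" by (subst (asm) powr_inj) auto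
  have "0 \<le> log 10 t" "log 10 t < 1" using t by (auto simp: log_less_one_cancel_iff)
  then have "frac y = log 10 t" unfolding y frac_unique_iff by simp
  with tl show "t = 10 powr frac y" by simp
qed

lemma benford_exp:
  assumes "\<And>t. 0 \<le> t \<Longrightarrow> t < 1 \<Longrightarrow>
    (\<lambda>N. real (card {n \<in> {1..N}. frac (L n / ln 10) \<le> t}) / real N) \<longlonglongrightarrow> t"
  shows "benford (\<lambda>n. exp (L n))"
  unfolding benford_def
proof (intro conjI allI impI)
  fix t :: real assume t: "1 \<le> t \<and> t < 10"
  have "exp (L n) = 10 powr (L n / ln 10)" for n by (simp add: powr_def)
  then have "significand (exp (L n)) \<le> t \<longleftrightarrow> frac (L n / ln 10) \<le> log 10 t" for n
    using t by (simp add: significand_powr le_log_iff)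
  moreover have "0 \<le> log 10 t" "log 10 t < 1" using t by auto
  ultimately show "(\<lambda>N. real (card {n \<in> {1..N}. significand (exp (L n)) \<le> t}) / real N) \<longlonglongrightarrow> log 10 t"
    using assms by simp
qed auto

section \<open>Almost everywhere statements for the denominators\<close>

theorem AE_phase_averages_tendsto_0:
  assumes "\<alpha> \<noteq> 0"
  shows "AE x in lborel. x \<in> {0<..<1} \<longrightarrow>
    (\<lambda>N. (\<Sum>n=1..N. cis (\<alpha> * log_denom n 0 x)) / of_nat N) \<longlonglongrightarrow> 0"
proof -
  define M where "M = restrict_space lborel {0<..<1::real}"
  interpret finite_measure M
    by (rule finite_measureI) (simp add: M_def emeasure_restrict_space space_restrict_space)
  obtain \<rho> where \<rho>: "0 \<le> \<rho>" "\<rho> < 1"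
    "\<And>m n r. r \<in> {0..1} \<Longrightarrow> cmod (phase_mean \<alpha> m (m + n) r) \<le> \<rho> ^ n"
    using phase_mean_decay[OF assms] by metis
  have meas [measurable]: "(\<lambda>x. \<alpha> * log_denom n 0 x) \<in> borel_measurable M" for n
    unfolding M_def by (rule measurable_restrict_space1) measurable
  \<comment> \<open>At ratio 0 the cylinder density is 1, so the correlation under Lebesgue measure
    is a \<open>phase_mean\<close>.\<close>
  have "(\<integral>x. cis (\<alpha> * log_denom n 0 x - \<alpha> * log_denom m 0 x) \<partial>M) = phase_mean \<alpha> m n 0" for m n
  proof -
    let ?f = "\<lambda>x. cis (\<alpha> * (log_denom n 0 x - log_denom m 0 x))"
    have "integrable M ?f"
      by (rule integrable_const_bound[where B = 1])
        (auto simp: M_def intro: measurable_restrict_space1 measurable_phase)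
    then have "set_integrable lborel {0<..<1} ?f"
      by (simp add: M_def integrable_restrict_space set_integrable_def)
    then have "integral\<^sup>L M ?f = integral {0<..<1} ?f"
      using set_borel_integral_eq_integral(2)
      by (simp add: M_def integral_restrict_space set_lebesgue_integral_def)
    then show ?thesis
      by (simp add: phase_mean_def cylinder_mean_def cylinder_density_def right_diff_distrib)
  qed
  with \<rho>(3)[of 0]
  have "(\<integral>x. (cmod (\<Sum>n=1..N. cis (\<alpha> * log_denom n 0 x)))\<^sup>2 \<partial>M) \<le> (measure M (space M) + 2 / (1 - \<rho>)) * real N" for N
    by (intro L2_sum_le[OF meas \<rho>(1,2)]) simp
  then have "AE x in M. (\<lambda>N. (\<Sum>n=1..N. cis (\<alpha> * log_denom n 0 x)) / of_nat N) \<longlonglongrightarrow> 0"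
    by (rule AE_averages_tendsto_0[rotated 2])
      (auto intro!: measurable_compose[OF meas] borel_measurable_continuous_onI continuous_intros)
  then show ?thesis unfolding M_def by (subst (asm) AE_restrict_space_iff) auto
qed

theorem theorem1p1:
  shows "AE x in lborel. x \<in> {0<..<1} \<longrightarrow> benford (\<lambda>n. real_of_int (cf_denom n x))"
proof -
  \<comment> \<open>Countably many frequencies share one null set. The factor
    \<open>2 * pi / ln 10\<close> turns the natural logarithm into the phase of the decimal one, and
    \<open>Suc h\<close> keeps the frequency nonzero.\<close>
  have "AE x in lborel. \<forall>h::nat. x \<in> {0<..<1} \<longrightarrow> (\<lambda>N. (\<Sum>n=1..N. cis (2 * pi * real (Suc h) / ln 10 * log_denom n 0 x)) / of_nat N) \<longlonglongrightarrow> 0"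
    unfolding AE_all_countable by (intro allI AE_phase_averages_tendsto_0) simp
  \<comment> \<open>On irrational points \<open>log_denom\<close> is the logarithm of the actual
    denominator.\<close>
  moreover have "AE x in lborel. x \<notin> (\<rat> :: real set)"
    by (intro AE_not_in countable_imp_null_set_lborel countable_rat)
  ultimately show ?thesis
  proof eventually_elim
    case (elim x)
    show ?case
    proof
      assume x: "x \<in> {0<..<1}"
      have "benford (\<lambda>n. exp (log_denom n 0 x))"
      proof (rule benford_exp, rule weyl_criterion)
        fix h :: nat assume "h \<ge> 1"
        then obtain k where "h = Suc k" by (cases h) auto
        with elim(1) x show "(\<lambda>N. (\<Sum>n=1..N. cis (2 * pi * real h * (log_denom n 0 x / ln 10))) / of_nat N) \<longlonglongrightarrow> 0"
          by (simp add: mult_ac)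
      qed auto
      then show "benford (\<lambda>n. real_of_int (cf_denom n x))"
        using cf_denom_eq[OF x elim(2)] by simp
    qed
  qed
qed

end
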